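(* Fix $\varepsilon>0$, $\gamma>0$, and $\alpha>0$. Let $\Psi=(\psi_1,\psi_2)\in\mathcal{D}_\alpha$ be a critical point of the energy $G_\varepsilon$ (on the half-line) satisfying $\psi_1(x)>\psi_2(x)>0$ for all $x\in(0,\infty)$. Then $(\psi_1,\psi_2)$ and $(\psi_2,\psi_1)$ are the only global minimizers of the energy $G_\varepsilon$ in $\mathcal{D}_\alpha$.
   Context: $\mathbb{R}_+=(0,\infty)$ and $L^{2,1}(\mathbb{R}_+)=\{f\in L^2(\mathbb{R}_+):|x|f\in L^2(\mathbb{R}_+)\}$. For $\alpha>0$, $$\mathcal{D}_\alpha=\{\Psi\in H^1(\mathbb{R}_+;\mathbb{R}^2)\cap L^{2,1}(\mathbb{R}_+;\mathbb{R}^2):\psi_1(0)=\psi_2(0)=\alpha\}.$$ On $\mathcal{D}_\alpha$ the energy is the half-line energy $$G_\varepsilon(\Psi)=\int_0^\infty\Big[\varepsilon^2(\psi_1')^2+\varepsilon^2(\psi_2')^2+(x^2-1)(\psi_1^2+\psi_2^2)+\tfrac12(\psi_1^2+\psi_2^2)^2+(\gamma-1)\psi_1^2\psi_2^2\Big]dx$$ (the overall positive normalization constant is immaterial). A critical point in $\mathcal{D}_\alpha$ is critical with respect to perturbations $\tilde\Psi\in H^1(\mathbb{R}_+;\mathbb{R}^2)\cap L^{2,1}(\mathbb{R}_+;\mathbb{R}^2)$ with $\tilde\Psi(0)=0$; equivalently, it solves on $(0,\infty)$ $$-\varepsilon^2\psi_1''+x^2\psi_1+(\psi_1^2+\gamma\psi_2^2-1)\psi_1=0,\qquad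 -\varepsilon^2\psi_2''+x^2\psi_2+(\gamma\psi_1^2+\psi_2^2-1)\psi_2=0.$$ *)

theory Defs
  imports "HOL-Analysis.Analysis"
begin

definition L2_halfline :: "(real \<Rightarrow> real) set" where
  "L2_halfline = {f. set_borel_measurable lebesgue {0<..} f \<and>
                     set_integrable lebesgue {0<..} (\<lambda>x. (f x)\<^sup>2)}"

definition L21_halfline :: "(real \<Rightarrow> real) set" where
  "L21_halfline = {f \<in> L2_halfline. (\<lambda>x. \<bar>x\<bar> * f x) \<in> L2_halfline}"

definition test_functions :: "(real \<Rightarrow> real) set" where
  "test_functions = {\<phi>. \<phi> C1_differentiable_on UNIV \<and>
     compact (closure {x. \<phi> x \<noteq> 0}) \<and> closure {x. \<phi> x \<noteq> 0} \<subseteq> {0<..}}"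

definition has_weak_derivative :: "(real \<Rightarrow> real) \<Rightarrow> (real \<Rightarrow> real) \<Rightarrow> bool" where
  "has_weak_derivative f g \<longleftrightarrow>
     (\<forall>\<phi>\<in>test_functions.
        (LINT x:{0<..}|lebesgue. f x * deriv \<phi> x) = - (LINT x:{0<..}|lebesgue. g x * \<phi> x))"

(* An element of the one-dimensional Sobolev space is represented by its continuous
   representative on the closed half-line, so that the boundary value f 0 and pointwise
   statements are meaningful. Values at negative arguments are irrelevant. *)
definition H1_halfline :: "(real \<Rightarrow> real) set" where
  "H1_halfline = {f \<in> L2_halfline. continuous_on {0..} f \<and>
                    (\<exists>g\<in>L2_halfline. has_weak_derivative f g)}"

(* Unique only up to null sets; it is used only under integrals. *)
definition weak_deriv :: "(real \<Rightarrow> real) \<Rightarrow> real \<Rightarrow> real" where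
  "weak_deriv f = (SOME g. g \<in> L2_halfline \<and> has_weak_derivative f g)"

definition admissible :: "real \<Rightarrow> ((real \<Rightarrow> real) \<times> (real \<Rightarrow> real)) set" where
  "admissible \<alpha> = {(\<psi>1, \<psi>2).
     \<psi>1 \<in> H1_halfline \<inter> L21_halfline \<and> \<psi>2 \<in> H1_halfline \<inter> L21_halfline \<and>
     \<psi>1 0 = \<alpha> \<and> \<psi>2 0 = \<alpha>}"

definition energy :: "real \<Rightarrow> real \<Rightarrow> (real \<Rightarrow> real) \<times> (real \<Rightarrow> real) \<Rightarrow> real" where
  "energy \<epsilon> \<gamma> = (\<lambda>(\<psi>1, \<psi>2).
     LINT x:{0<..}|lebesgue.
       \<epsilon>\<^sup>2 * (weak_deriv \<psi>1 x)\<^sup>2 + \<epsilon>\<^sup>2 * (weak_deriv \<psi>2 x)\<^sup>2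
       + (x\<^sup>2 - 1) * ((\<psi>1 x)\<^sup>2 + (\<psi>2 x)\<^sup>2)
       + 1/2 * ((\<psi>1 x)\<^sup>2 + (\<psi>2 x)\<^sup>2)\<^sup>2
       + (\<gamma> - 1) * (\<psi>1 x)\<^sup>2 * (\<psi>2 x)\<^sup>2)"

(* The space of admissible perturbations (both components vanishing at the origin)
   is admissible 0. *)
definition critical_point ::
  "real \<Rightarrow> real \<Rightarrow> real \<Rightarrow> (real \<Rightarrow> real) \<times> (real \<Rightarrow> real) \<Rightarrow> bool" where
  "critical_point \<epsilon> \<gamma> \<alpha> = (\<lambda>(\<psi>1, \<psi>2). (\<psi>1, \<psi>2) \<in> admissible \<alpha> \<and>
     (\<forall>(\<phi>1, \<phi>2)\<in>admissible 0.
        ((\<lambda>t. energy \<epsilon> \<gamma> (\<lambda>x. \<psi>1 x + t * \<phi>1 x, \<lambda>x. \<psi>2 x + t * \<phi>2 x))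
           has_real_derivative 0) (at 0)))"

definition global_minimizer ::
  "real \<Rightarrow> real \<Rightarrow> real \<Rightarrow> (real \<Rightarrow> real) \<times> (real \<Rightarrow> real) \<Rightarrow> bool" where
  "global_minimizer \<epsilon> \<gamma> \<alpha> \<Psi> \<longleftrightarrow> \<Psi> \<in> admissible \<alpha> \<and>
     (\<forall>\<Phi>\<in>admissible \<alpha>. energy \<epsilon> \<gamma> \<Psi> \<le> energy \<epsilon> \<gamma> \<Phi>)"

(* Equality as functions on the closed half-line. *)
definition halfline_eq ::
  "(real \<Rightarrow> real) \<times> (real \<Rightarrow> real) \<Rightarrow> (real \<Rightarrow> real) \<times> (real \<Rightarrow> real) \<Rightarrow> bool" where
  "halfline_eq = (\<lambda>(\<phi>1, \<phi>2) (\<psi>1, \<psi>2). \<forall>x\<ge>0. \<phi>1 x = \<psi>1 x \<and> \<phi>2 x = \<psi>2 x)"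

end

theory Submission
  imports Defs
begin


text \<open>
  With $a = \psi_1 + \psi_2$ and $b = \psi_1 - \psi_2$, both positive on $(0,\infty)$, the interaction term
  becomes the quadratic form $\frac1{16}[(\gamma+1)(A^2+B^2) + 2(3-\gamma)AB]$ in $A = a^2$, $B = b^2$, which is
  positive definite exactly for $\gamma > 1$. Since $\Psi$ is critical, adding a perturbation that changes
  $a$ by $h$ and $b$ by $k$ changes the energy by $\frac12 Q_a(h) + \frac12 Q_b(k)$ plus that form evaluated at
  the increments of $A$ and $B$. Here $Q_a$, $Q_b$ are the quadratic forms of the linear Schroedinger
  operators annihilating $a$ and $b$. They are nonnegative on functions vanishing at $0$: with the
  Riccati variable $p = u'/u$ of the positive solution $u$, the integrand
  $\varepsilon^2 \eta'^2 + V\eta^2$ is $\varepsilon^2 (p\eta^2)'$ plus a square. In the case of equality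
  $A$ and $B$ are unchanged, which leaves only $(\psi_1,\psi_2)$ and $(\psi_2,\psi_1)$.

  The case $\gamma \le 1$ is vacuous: the Wronskian $ab' - a'b$ would be nondecreasing and integrable near infinity,
  hence nonpositive, so $b/a$ would be nonincreasing from its value $0$ at the origin.
\<close>

section \<open>Products of absolutely continuous functions\<close>

text \<open>In the notation above, the expansion is exact for perturbations of any size because the
  density, apart from its kinetic term, is a quadratic polynomial in A and B. The increments of A
  and B are \<open>2 a h + h^2\<close> and \<open>2 b k + k^2\<close>, and their first-order
  coefficients are half the potentials in the equations for a and b. Criticality removes what is
  linear in h and k; the leftovers \<open>h^2\<close> and \<open>k^2\<close> join the kinetic terms
  in Q_a and Q_b. Two obstacles shape the rest. Derivatives are weak and arbitrarily chosen, while
  the Riccati and Wronskian arguments are pointwise. Hence functions are handled through primitives,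
  with a product rule proved by Fubini, and a and b are shown to be twice differentiable on the open
  half-line. Moreover, nothing is known beforehand about u'/u near 0, where b vanishes, or at
  infinity. Boundary terms are therefore bounded from one side by comparison functions, and
  integrability supplies arbitrarily large points where such a bound is small.\<close>

lemma integral_eq_lebesgue_on:
  fixes f :: "real \<Rightarrow> real"
  assumes "f absolutely_integrable_on S" "S \<in> sets lebesgue"
  shows "integral S f = integral\<^sup>L (lebesgue_on S) f" "integrable (lebesgue_on S) f"
proof -
  show i: "integrable (lebesgue_on S) f"
    using assms by (simp add: set_integrable_def integrable_restrict_space)
  show "integral S f = integral\<^sup>L (lebesgue_on S) f"
    using i assms(2) by (simp add: lebesgue_integral_eq_integral)
qed

lemma continuous_on_antiderivative:
  fixes f g :: "real \<Rightarrow> real"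
  assumes "g absolutely_integrable_on {a..b}"
    and "\<And>x. x \<in> {a..b} \<Longrightarrow> integral {a..x} g = f x - f a"
  shows "continuous_on {a..b} f"
proof -
  have "continuous_on {a..b} (\<lambda>x. f a + integral {a..x} g)"
    using assms(1) absolutely_integrable_on_def
    by (intro continuous_intros indefinite_integral_continuous_1) blast
  then show ?thesis
    by (rule continuous_on_eq) (use assms(2) in simp)
qed

lemma absolutely_integrable_continuous_mult:
  fixes f g :: "real \<Rightarrow> real"
  assumes "continuous_on {a..b} f" "g absolutely_integrable_on {a..b}"
  shows "(\<lambda>x. f x * g x) absolutely_integrable_on {a..b}" "(\<lambda>x. g x * f x) absolutely_integrable_on {a..b}"
proof -
  show "(\<lambda>x. f x * g x) absolutely_integrable_on {a..b}"
  proof (rule absolutely_integrable_bounded_measurable_product_real[OF _ _ _ assms(2)])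
  show "f \<in> borel_measurable (lebesgue_on {a..b})"
    by (rule continuous_imp_measurable_on_sets_lebesgue[OF assms(1)]) simp
  show "bounded (f ` {a..b})"
    using assms(1) compact_Icc compact_continuous_image compact_imp_bounded by blast
  qed simp
  then show "(\<lambda>x. g x * f x) absolutely_integrable_on {a..b}" by (simp only: mult.commute)
qed

text \<open>Fubini for \<open>g x * k y\<close> on the square: cutting along the diagonal, each
  triangle gives one of the two integrals on the left. Only integrability of \<open>g\<close> and
  \<open>k\<close> enters, so no primitive has to be differentiated.\<close>

lemma indefinite_integral_by_parts:
  fixes g k :: "real \<Rightarrow> real"
  assumes g: "g absolutely_integrable_on {a..b}" and k: "k absolutely_integrable_on {a..b}"
  shows "integral {a..b} (\<lambda>x. g x * integral {a..x} k) + integral {a..b} (\<lambda>x. integral {a..x} g * k x)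
    = integral {a..b} g * integral {a..b} k"
proof -
  define M where "M = lebesgue_on {a..b}"
  have fin: "finite_measure M" unfolding M_def by (rule finite_measure_lebesgue_on) auto
  interpret M: finite_measure M by fact
  interpret P: pair_sigma_finite M M by standard
  have gi: "integrable M g" and ki: "integrable M k"
    unfolding M_def using g k by (auto intro: integral_eq_lebesgue_on)
  have [measurable]: "g \<in> borel_measurable M" "k \<in> borel_measurable M"
    using gi ki by auto
  have [measurable]: "(\<lambda>x. x) \<in> borel_measurable M"
    unfolding M_def by (simp add: continuous_imp_measurable_on_sets_lebesgue)
  define T where "T x y = g x * k y" for x y
  \<comment> \<open>The diagonal is assigned to \<open>A\<close> alone, so that
    \<open>T = A + B\<close> holds everywhere; the inner integral of \<open>B\<close> then runs over
    a half-open interval, which differs from the closed one by a null set.\<close>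
  define A where "A x y = g x * k y * of_bool (y \<le> x)" for x y
  define B where "B x y = g x * k y * of_bool (x < y)" for x y
  have TAB: "T x y = A x y + B x y" for x y
    unfolding T_def A_def B_def by auto
  have meas [measurable]: "(\<lambda>(x,y). T x y) \<in> borel_measurable (M \<Otimes>\<^sub>M M)"
      "(\<lambda>(x,y). A x y) \<in> borel_measurable (M \<Otimes>\<^sub>M M)"
      "(\<lambda>(x,y). B x y) \<in> borel_measurable (M \<Otimes>\<^sub>M M)"
    unfolding T_def A_def B_def by measurable
  have Ti: "integrable (M \<Otimes>\<^sub>M M) (\<lambda>(x,y). T x y)"
    by (rule P.Fubini_integrable) (auto simp: T_def gi ki abs_mult)
  have Ai: "integrable (M \<Otimes>\<^sub>M M) (\<lambda>(x,y). A x y)" and Bi: "integrable (M \<Otimes>\<^sub>M M) (\<lambda>(x,y). B x y)"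
    by (rule Bochner_Integration.integrable_bound[OF Ti]; auto simp: T_def A_def B_def)+
  have gs: "g absolutely_integrable_on {a..x}" and ks: "k absolutely_integrable_on {a..x}" if "x \<in> {a..b}" for x
    using g k that by (auto intro: absolutely_integrable_on_subinterval)
  have Ain: "integral\<^sup>L M (A x) = g x * integral {a..x} k" if "x \<in> {a..b}" for x
  proof -
    have "integral\<^sup>L M (A x) = g x * integral\<^sup>L M (\<lambda>y. k y * of_bool (y \<le> x))"
      unfolding A_def by (simp add: mult.assoc)
    also have "integral\<^sup>L M (\<lambda>y. k y * of_bool (y \<le> x)) = integral\<^sup>L lebesgue (\<lambda>y. indicator {a..x} y * k y)"
      unfolding M_def using that
      by (subst integral_restrict_space) (auto intro!: Bochner_Integration.integral_cong simp: indicator_def)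
    also have "\<dots> = integral {a..x} k"
      using set_lebesgue_integral_eq_integral(2)[OF ks[OF that]] by (simp add: set_lebesgue_integral_def)
    finally show ?thesis .
  qed
  have Bin: "integral\<^sup>L M (\<lambda>x. B x y) = integral {a..y} g * k y" if "y \<in> {a..b}" for y
  proof -
    have "integral\<^sup>L M (\<lambda>x. B x y) = k y * integral\<^sup>L M (\<lambda>x. g x * of_bool (x < y))"
      unfolding B_def by (subst integral_mult_right_zero[symmetric]) (simp add: ac_simps)
    also have "integral\<^sup>L M (\<lambda>x. g x * of_bool (x < y)) = integral\<^sup>L lebesgue (\<lambda>x. indicator {a..<y} x * g x)"
      unfolding M_def using that
      by (subst integral_restrict_space) (auto intro!: Bochner_Integration.integral_cong simp: indicator_def)
    also have "\<dots> = integral {a..<y} g"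
    proof -
      have "set_integrable lebesgue {a..<y} g"
        by (rule set_integrable_subset[OF gs[OF that]]) auto
      from set_lebesgue_integral_eq_integral(2)[OF this] show ?thesis
        by (simp add: set_lebesgue_integral_def)
    qed
    also have "\<dots> = integral {a..y} g"
      by (rule integral_spike_set) (auto intro: negligible_subset[of "{y}"])
    finally show ?thesis by simp
  qed
  have eqA: "integral\<^sup>L (M \<Otimes>\<^sub>M M) (\<lambda>(x,y). A x y) = integral {a..b} (\<lambda>x. g x * integral {a..x} k)"
  proof -
    have "continuous_on {a..b} (\<lambda>x. integral {a..x} k)"
      using k absolutely_integrable_on_def by (intro indefinite_integral_continuous_1) blast
    then have ai: "(\<lambda>x. g x * integral {a..x} k) absolutely_integrable_on {a..b}"
      by (rule absolutely_integrable_continuous_mult(2)[OF _ g])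
    have "integral\<^sup>L (M \<Otimes>\<^sub>M M) (\<lambda>(x,y). A x y) = integral\<^sup>L M (\<lambda>x. integral\<^sup>L M (A x))"
      using P.integral_fst'[OF Ai] by simp
    also have "\<dots> = integral\<^sup>L M (\<lambda>x. g x * integral {a..x} k)"
      by (rule Bochner_Integration.integral_cong) (use Ain in \<open>auto simp: M_def\<close>)
    also have "\<dots> = integral {a..b} (\<lambda>x. g x * integral {a..x} k)"
      unfolding M_def using ai by (subst integral_eq_lebesgue_on) auto
    finally show ?thesis .
  qed
  have eqB: "integral\<^sup>L (M \<Otimes>\<^sub>M M) (\<lambda>(x,y). B x y) = integral {a..b} (\<lambda>y. integral {a..y} g * k y)"
  proof -
    have "continuous_on {a..b} (\<lambda>x. integral {a..x} g)"
      using g absolutely_integrable_on_def by (intro indefinite_integral_continuous_1) blast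
    then have ai: "(\<lambda>x. integral {a..x} g * k x) absolutely_integrable_on {a..b}"
      by (rule absolutely_integrable_continuous_mult(1)[OF _ k])
    have "integral\<^sup>L (M \<Otimes>\<^sub>M M) (\<lambda>(x,y). B x y) = integral\<^sup>L M (\<lambda>y. integral\<^sup>L M (\<lambda>x. B x y))"
      using P.integral_snd[OF Bi] by simp
    also have "\<dots> = integral\<^sup>L M (\<lambda>y. integral {a..y} g * k y)"
      by (rule Bochner_Integration.integral_cong) (use Bin in \<open>auto simp: M_def\<close>)
    also have "\<dots> = integral {a..b} (\<lambda>y. integral {a..y} g * k y)"
      unfolding M_def using ai by (subst integral_eq_lebesgue_on) auto
    finally show ?thesis .
  qed
  have "integral\<^sup>L (M \<Otimes>\<^sub>M M) (\<lambda>(x,y). T x y) = integral\<^sup>L M (\<lambda>x. integral\<^sup>L M (T x))"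
    using P.integral_fst'[OF Ti] by simp
  also have "\<dots> = integral\<^sup>L M g * integral\<^sup>L M k"
    unfolding T_def by simp
  also have "\<dots> = integral {a..b} g * integral {a..b} k"
    unfolding M_def using g k by (subst (1 2) integral_eq_lebesgue_on) auto
  finally have "integral\<^sup>L (M \<Otimes>\<^sub>M M) (\<lambda>(x,y). T x y) = integral {a..b} g * integral {a..b} k" .
  moreover have "integral\<^sup>L (M \<Otimes>\<^sub>M M) (\<lambda>(x,y). T x y) =
      integral\<^sup>L (M \<Otimes>\<^sub>M M) (\<lambda>(x,y). A x y) + integral\<^sup>L (M \<Otimes>\<^sub>M M) (\<lambda>(x,y). B x y)"
    using Bochner_Integration.integral_add[OF Ai Bi] by (simp add: TAB split_beta')
  ultimately show ?thesis using eqA eqB by simp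
qed

text \<open>The product rule for absolutely continuous functions in integrated form. After writing
  \<open>f\<close> and \<open>h\<close> as their value at \<open>a\<close> plus a primitive, the
  only nontrivial term is the double integral of the preceding lemma. It serves as integration by
  parts wherever a factor has merely an integrable derivative.\<close>

lemma antiderivative_mult:
  fixes f g h k :: "real \<Rightarrow> real"
  assumes ab: "a \<le> b"
    and g: "g absolutely_integrable_on {a..b}" and k: "k absolutely_integrable_on {a..b}"
    and f: "\<And>x. x \<in> {a..b} \<Longrightarrow> integral {a..x} g = f x - f a"
    and h: "\<And>x. x \<in> {a..b} \<Longrightarrow> integral {a..x} k = h x - h a"
  shows "(\<lambda>x. g x * h x + f x * k x) absolutely_integrable_on {a..b}" (is ?A)
    and "integral {a..b} (\<lambda>x. g x * h x + f x * k x) = f b * h b - f a * h a" (is ?B)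
proof -
  have cf: "continuous_on {a..b} f" and ch: "continuous_on {a..b} h"
    using continuous_on_antiderivative[OF g f] continuous_on_antiderivative[OF k h] by auto
  show ?A
    using absolutely_integrable_continuous_mult(2)[OF ch g] absolutely_integrable_continuous_mult(1)[OF cf k]
    by (rule set_integral_add(1))
  have cG: "continuous_on {a..b} (\<lambda>x. integral {a..x} g)" and cK: "continuous_on {a..b} (\<lambda>x. integral {a..x} k)"
    using g k absolutely_integrable_on_def by (intro indefinite_integral_continuous_1; blast)+
  have i1: "(\<lambda>x. g x * integral {a..x} k) integrable_on {a..b}"
    using absolutely_integrable_continuous_mult(2)[OF cK g] absolutely_integrable_on_def by blast
  have i2: "(\<lambda>x. integral {a..x} g * k x) integrable_on {a..b}"
    using absolutely_integrable_continuous_mult(1)[OF cG k] absolutely_integrable_on_def by blast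
  have gi: "g integrable_on {a..b}" "k integrable_on {a..b}"
    using g k absolutely_integrable_on_def by auto
  have "integral {a..b} (\<lambda>x. g x * h x + f x * k x) =
     integral {a..b} (\<lambda>x. (h a * g x + f a * k x) + (g x * integral {a..x} k + integral {a..x} g * k x))"
  proof (rule integral_cong)
    fix x assume x: "x \<in> {a..b}"
    show "g x * h x + f x * k x = h a * g x + f a * k x + (g x * integral {a..x} k + integral {a..x} g * k x)"
      unfolding f[OF x] h[OF x] by (simp add: algebra_simps)
  qed
  also have "\<dots> = (h a * integral {a..b} g + f a * integral {a..b} k) + (integral {a..b} (\<lambda>x. g x * integral {a..x} k)
      + integral {a..b} (\<lambda>x. integral {a..x} g * k x))"
    by (intro integral_unique has_integral_add has_integral_mult_right integrable_integral i1 i2 gi)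
  also have "\<dots> = (h a * integral {a..b} g + f a * integral {a..b} k) + integral {a..b} g * integral {a..b} k"
    by (simp only: indefinite_integral_by_parts[OF g k])
  also have "\<dots> = f b * h b - f a * h a"
  proof -
    have b: "b \<in> {a..b}" using ab by simp
    show ?thesis unfolding f[OF b] h[OF b] by (simp add: algebra_simps)
  qed
  finally show ?B .
qed


section \<open>Weak derivatives on the half-line\<close>

lemma DERIV_pos_part_squared:
  "((\<lambda>x::real. (max 0 x)\<^sup>2) has_real_derivative 2 * max 0 x) (at x)"
proof -
  consider "x < 0" | "x > 0" | "x = 0" by linarith
  then show ?thesis
  proof cases
    case 1
    have "((\<lambda>x::real. 0) has_real_derivative 0) (at x)" by simp
    then have "((\<lambda>x::real. (max 0 x)\<^sup>2) has_real_derivative 0) (at x)"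
      by (rule has_field_derivative_transform_within_open[of _ _ _ "{..<0}"]) (use 1 in auto)
    with 1 show ?thesis by simp
  next
    case 2
    have "((\<lambda>x::real. x\<^sup>2) has_real_derivative 2 * x) (at x)" by (auto intro!: derivative_eq_intros)
    then have "((\<lambda>x::real. (max 0 x)\<^sup>2) has_real_derivative 2 * x) (at x)"
      by (rule has_field_derivative_transform_within_open[of _ _ _ "{0<..}"]) (use 2 in auto)
    with 2 show ?thesis by simp
  next
    case 3
    have "((\<lambda>h::real. ((max 0 h)\<^sup>2) / h) \<longlongrightarrow> 0) (at 0)"
    proof (rule Lim_null_comparison)
      show "\<forall>\<^sub>F h::real in at 0. norm (((max 0 h)\<^sup>2) / h) \<le> \<bar>h\<bar>"
        by (auto simp: eventually_at_filter max_def power2_eq_square)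
      show "((\<lambda>h::real. \<bar>h\<bar>) \<longlongrightarrow> 0) (at 0)"
        by (simp add: tendsto_rabs_zero)
    qed
    then show ?thesis using 3 by (simp add: DERIV_def)
  qed
qed

text \<open>The function climbs just after \<open>s\<close>, stays constant and descends just after
  \<open>t\<close>. Its derivative is a positive hat at one place and the mirrored negative hat at
  the other, which compares averages near the two points.\<close>

lemma exists_plateau_test_function:
  fixes s t d :: real
  assumes "0 < s" "0 < d" "s + d \<le> t"
  obtains \<phi> where "\<phi> \<in> test_functions"
    "\<And>x. (\<phi> has_real_derivative deriv \<phi> x) (at x)"
    "continuous_on UNIV (deriv \<phi>)"
    "\<And>x. x \<notin> {s<..<t+d} \<Longrightarrow> \<phi> x = 0"
    "\<And>x. x \<notin> {s<..<s+d} \<union> {t<..<t+d} \<Longrightarrow> deriv \<phi> x = 0"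
    "\<And>x. x \<in> {s<..<s+d} \<Longrightarrow> deriv \<phi> x > 0"
    "\<And>x. x \<in> {t<..<t+d} \<Longrightarrow> deriv \<phi> x < 0"
proof -
  define q where "q x = (max 0 x)\<^sup>2" for x :: real
  \<comment> \<open>A C1 step from \<open>0\<close> to \<open>d^2 / 2\<close>: the second difference
    of \<open>q\<close> has as derivative \<open>\<tau>\<close>, the hat on \<open>{0..d}\<close>
    with peak at \<open>d/2\<close>.\<close>
  define S where "S x = q x - 2 * q (x - d/2) + q (x - d)" for x
  define \<tau> where "\<tau> x = 2 * max 0 x - 4 * max 0 (x - d/2) + 2 * max 0 (x - d)" for x
  define \<phi> where "\<phi> x = S (x - s) - S (x - t)" for x
  define \<phi>' where "\<phi>' x = \<tau> (x - s) - \<tau> (x - t)" for x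
  note q_deriv = DERIV_pos_part_squared[folded q_def]
  have dS: "(S has_real_derivative \<tau> x) (at x)" for x
    unfolding S_def[abs_def] \<tau>_def
    by (rule derivative_eq_intros DERIV_chain2[OF q_deriv] refl | simp)+
  have der: "(\<phi> has_real_derivative \<phi>' x) (at x)" for x
    unfolding \<phi>_def[abs_def] \<phi>'_def
    by (rule derivative_eq_intros DERIV_chain2[OF dS] refl | simp)+
  have dphi: "deriv \<phi> = \<phi>'" using der DERIV_imp_deriv by blast
  have cont: "continuous_on UNIV \<phi>'"
    unfolding \<phi>'_def \<tau>_def by (intro continuous_intros)
  have S0: "S x = 0" if "x \<le> 0" for x
    using that assms unfolding S_def q_def by (simp add: max_def)
  have S1: "S x = d\<^sup>2 / 2" if "x \<ge> d" for x
    using that assms unfolding S_def q_def by (simp add: max_def power2_eq_square field_simps)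
  have t0: "\<tau> x = 0" if "x \<le> 0 \<or> x \<ge> d" for x
    using that assms unfolding \<tau>_def by (auto simp: max_def)
  have tp: "\<tau> x > 0" if "0 < x" "x < d" for x
    using that assms unfolding \<tau>_def by (auto simp: max_def)
  have supp: "\<phi> x = 0" if "x \<notin> {s<..<t+d}" for x
  proof -
    have "x \<le> s \<or> x \<ge> t + d" using that by auto
    then show ?thesis
    proof
      assume "x \<le> s" then show ?thesis using assms S0[of "x-s"] S0[of "x-t"] by (simp add: \<phi>_def)
    next
      assume "x \<ge> t + d" then show ?thesis using assms S1[of "x-s"] S1[of "x-t"] by (simp add: \<phi>_def)
    qed
  qed
  have sub: "closure {x. \<phi> x \<noteq> 0} \<subseteq> {s..t+d}"
  proof (rule closure_minimal)
    show "{x. \<phi> x \<noteq> 0} \<subseteq> {s..t+d}"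
    proof
      fix x assume "x \<in> {x. \<phi> x \<noteq> 0}"
      then have "x \<in> {s<..<t+d}" using supp[of x] by blast
      then show "x \<in> {s..t+d}" by simp
    qed
  qed simp
  have "compact (closure {x. \<phi> x \<noteq> 0})"
    using sub by (meson bounded_closed_interval bounded_subset closed_closure compact_eq_bounded_closed)
  moreover have "\<phi> C1_differentiable_on UNIV"
    unfolding C1_differentiable_on_def using der cont
    by (auto simp: has_real_derivative_iff_has_vector_derivative intro!: exI[of _ \<phi>'])
  ultimately have "\<phi> \<in> test_functions"
    using sub assms unfolding test_functions_def by auto
  show ?thesis
  proof (rule that[of \<phi>])
    show "\<phi> \<in> test_functions" by fact
    show "(\<phi> has_real_derivative deriv \<phi> x) (at x)" for x using der dphi by simp
    show "continuous_on UNIV (deriv \<phi>)" using cont dphi by simp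
    show "\<phi> x = 0" if "x \<notin> {s<..<t+d}" for x using supp that by blast
    show "deriv \<phi> x = 0" if "x \<notin> {s<..<s+d} \<union> {t<..<t+d}" for x
      using that assms t0[of "x-s"] t0[of "x-t"] unfolding dphi \<phi>'_def by force
    show "deriv \<phi> x > 0" if "x \<in> {s<..<s+d}" for x
      using that assms tp[of "x-s"] t0[of "x-t"] unfolding dphi \<phi>'_def by force
    show "deriv \<phi> x < 0" if "x \<in> {t<..<t+d}" for x
      using that assms tp[of "x-t"] t0[of "x-s"] unfolding dphi \<phi>'_def by force
  qed
qed

text \<open>Du Bois-Reymond argument for a continuous function. If the two values differed, a
  plateau function with narrow flanks would see \<open>r\<close> on opposite sides of the midpoint
  of these values, and the integral could not vanish. The interval reaches to \<open>t+1\<close>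
  because the descending flank lies to the right of \<open>t\<close>.\<close>

lemma weakly_constant_imp_constant:
  fixes r :: "real \<Rightarrow> real"
  assumes st: "0 < s" "s < t" and r: "continuous_on {s..t+1} r"
    and weak: "\<And>\<phi>. \<phi> \<in> test_functions \<Longrightarrow> continuous_on UNIV (deriv \<phi>) \<Longrightarrow>
        (\<And>x. (\<phi> has_real_derivative deriv \<phi> x) (at x)) \<Longrightarrow>
        (\<And>x. x \<notin> {s<..<t+1} \<Longrightarrow> \<phi> x = 0) \<Longrightarrow> (\<And>x. x \<notin> {s<..<t+1} \<Longrightarrow> deriv \<phi> x = 0) \<Longrightarrow>
        integral {s..t+1} (\<lambda>x. r x * deriv \<phi> x) = 0"
  shows "r s = r t"
proof (rule ccontr)
  assume ne: "r s \<noteq> r t"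
  define m where "m = (r s + r t) / 2"
  \<comment> \<open>Subtracting \<open>m\<close> is harmless because \<open>deriv \<phi>\<close> has
    integral zero; the factor \<open>r t - r s\<close> makes \<open>h\<close> negative at
    \<open>s\<close> and positive at \<open>t\<close> whichever value is larger, so
    \<open>h * deriv \<phi>\<close> is nonpositive everywhere.\<close>
  define h where "h x = (r t - r s) * (r x - m)" for x
  have hs: "h s = - ((r t - r s)\<^sup>2) / 2" "h t = ((r t - r s)\<^sup>2) / 2"
    unfolding h_def m_def by (auto simp: power2_eq_square field_simps)
  have pos: "(r t - r s)\<^sup>2 > 0" using ne by simp
  have ch: "continuous_on {s..t+1} h" unfolding h_def by (intro continuous_intros r)
  have e: "(r t - r s)\<^sup>2 / 2 > 0" using pos by simp
  obtain d1 where d1: "d1 > 0" "\<And>x. x \<in> {s..t+1} \<Longrightarrow> dist x s < d1 \<Longrightarrow> dist (h x) (h s) < (r t - r s)\<^sup>2 / 2"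
    using ch[unfolded continuous_on_iff, rule_format, of s, OF _ e] st by auto
  obtain d2 where d2: "d2 > 0" "\<And>x. x \<in> {s..t+1} \<Longrightarrow> dist x t < d2 \<Longrightarrow> dist (h x) (h t) < (r t - r s)\<^sup>2 / 2"
    using ch[unfolded continuous_on_iff, rule_format, of t, OF _ e] st by auto
  \<comment> \<open>\<open>t - s\<close> keeps the flanks disjoint, \<open>1\<close> keeps the
    support inside \<open>{s..t+1}\<close>, and \<open>d1\<close>, \<open>d2\<close> secure the sign
    of \<open>h\<close> on the flanks.\<close>
  define d where "d = min (min d1 d2) (min 1 (t - s))"
  have d: "d > 0" "d \<le> d1" "d \<le> d2" "d \<le> 1" "s + d \<le> t"
    using d1(1) d2(1) st unfolding d_def by auto
  obtain \<phi> where \<phi>: "\<phi> \<in> test_functions"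
    "\<And>x. (\<phi> has_real_derivative deriv \<phi> x) (at x)"
    "continuous_on UNIV (deriv \<phi>)"
    "\<And>x. x \<notin> {s<..<t+d} \<Longrightarrow> \<phi> x = 0"
    "\<And>x. x \<notin> {s<..<s+d} \<union> {t<..<t+d} \<Longrightarrow> deriv \<phi> x = 0"
    "\<And>x. x \<in> {s<..<s+d} \<Longrightarrow> deriv \<phi> x > 0"
    "\<And>x. x \<in> {t<..<t+d} \<Longrightarrow> deriv \<phi> x < 0"
    using exists_plateau_test_function[OF st(1) d(1,5)] by metis
  have hneg: "h x < 0" if "x \<in> {s<..<s+d}" for x
  proof -
    have "dist (h x) (h s) < (r t - r s)\<^sup>2 / 2" by (rule d1(2)) (use that d st in \<open>auto simp: dist_real_def\<close>)
    then show ?thesis unfolding hs dist_real_def abs_less_iff by linarith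
  qed
  have hpos: "h x > 0" if "x \<in> {t<..<t+d}" for x
  proof -
    have "dist (h x) (h t) < (r t - r s)\<^sup>2 / 2" by (rule d2(2)) (use that d st in \<open>auto simp: dist_real_def\<close>)
    then show ?thesis unfolding hs dist_real_def abs_less_iff by linarith
  qed
  have cd: "continuous_on {s..t+1} (deriv \<phi>)" using \<phi>(3) continuous_on_subset by blast
  have i1: "integral {s..t+1} (\<lambda>x. r x * deriv \<phi> x) = 0"
  proof (rule weak[OF \<phi>(1) \<phi>(3) \<phi>(2)])
    show "\<phi> x = 0" if "x \<notin> {s<..<t+1}" for x using that d by (intro \<phi>(4)) auto
    show "deriv \<phi> x = 0" if "x \<notin> {s<..<t+1}" for x using that d st by (intro \<phi>(5)) auto
  qed
  have "(\<lambda>x. r x * deriv \<phi> x) integrable_on {s..t+1}"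
    by (intro integrable_continuous_real continuous_on_mult r cd)
  then have i1': "((\<lambda>x. r x * deriv \<phi> x) has_integral 0) {s..t+1}"
    using i1 integrable_integral by fastforce
  have "((deriv \<phi>) has_integral (\<phi> (t+1) - \<phi> s)) {s..t+1}"
    using \<phi>(2) st
    by (intro fundamental_theorem_of_calculus)
       (auto simp: has_real_derivative_iff_has_vector_derivative[symmetric] intro: has_field_derivative_at_within)
  moreover have "\<phi> (t+1) - \<phi> s = 0" using \<phi>(4)[of s] \<phi>(4)[of "t+1"] d st by auto
  ultimately have i2: "((deriv \<phi>) has_integral 0) {s..t+1}" by simp
  have "((\<lambda>x. (r t - r s) * (r x * deriv \<phi> x) - ((r t - r s) * m) * deriv \<phi> x) has_integral
          ((r t - r s) * 0 - ((r t - r s) * m) * 0)) {s..t+1}"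
    by (intro has_integral_diff has_integral_mult_right i2 i1')
  moreover have "(r t - r s) * (r x * deriv \<phi> x) - ((r t - r s) * m) * deriv \<phi> x = h x * deriv \<phi> x" for x
    by (simp add: h_def algebra_simps)
  ultimately have "((\<lambda>x. h x * deriv \<phi> x) has_integral 0) {s..t+1}"
    by (simp only: mult_zero_right diff_0_right)
  then have "((\<lambda>x. - (h x * deriv \<phi> x)) has_integral 0) {s..t+1}"
    by (auto dest: has_integral_neg)
  then have "integral {s..t+1} (\<lambda>x. - (h x * deriv \<phi> x)) = 0"
    by (rule integral_unique)
  moreover have "- (h x * deriv \<phi> x) \<ge> 0" if "x \<in> {s..t+1}" for x
  proof -
    consider "x \<in> {s<..<s+d}" | "x \<in> {t<..<t+d}" | "x \<notin> {s<..<s+d} \<union> {t<..<t+d}" by blast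
    then show ?thesis
    proof cases
      case 1 then show ?thesis using hneg[OF 1] \<phi>(6)[OF 1] by (simp add: mult_le_0_iff)
    next
      case 2 then show ?thesis using hpos[OF 2] \<phi>(7)[OF 2] by (simp add: mult_le_0_iff)
    next
      case 3 then show ?thesis using \<phi>(5)[OF 3] by simp
    qed
  qed
  moreover have "continuous_on {s..t+1} (\<lambda>x. - (h x * deriv \<phi> x))"
    by (intro continuous_intros ch cd)
  ultimately have "\<forall>x\<in>{s..t+1}. - (h x * deriv \<phi> x) = 0"
    using integral_eq_0_iff[of s "t+1" "\<lambda>x. - (h x * deriv \<phi> x)"] st by simp
  then have "h (s + d/2) * deriv \<phi> (s + d/2) = 0" using d st by auto
  moreover have "h (s + d/2) < 0" "deriv \<phi> (s+d/2) > 0"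
    using hneg[of "s+d/2"] \<phi>(6)[of "s+d/2"] d by auto
  ultimately show False by simp
qed


section \<open>Functions whose integrals vanish\<close>

text \<open>The positive and negative parts are densities of measures that agree, with finite
  values, on all rays. Rays determine such measures on Borel sets, and densities are unique almost
  everywhere.\<close>

lemma AE_eq_0_if_rays_lborel:
  fixes d :: "real \<Rightarrow> real"
  assumes d: "integrable lborel d"
    and zero: "\<And>x. (\<integral>y. d y * indicator {x<..} y \<partial>lborel) = 0"
  shows "AE x in lborel. d x = 0"
proof -
  have [measurable]: "d \<in> borel_measurable lborel" using d by auto
  define p where "p y = ennreal (max 0 (d y))" for y
  define n where "n y = ennreal (max 0 (- d y))" for y
  have [measurable]: "p \<in> borel_measurable lborel" "n \<in> borel_measurable lborel"
    unfolding p_def n_def by measurable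
  have pir: "integrable lborel (\<lambda>y. max 0 (f y) * indicator {x<..} y)" if "integrable lborel f" for f :: "real \<Rightarrow> real" and x
    using that by (auto intro!: integrable_real_mult_indicator integrable_max)
  have dens: "emeasure (density lborel (\<lambda>y. ennreal (max 0 (f y)))) {x<..}
      = ennreal (\<integral>y. max 0 (f y) * indicator {x<..} y \<partial>lborel)" if f: "integrable lborel f" for f :: "real \<Rightarrow> real" and x
  proof -
    have [measurable]: "f \<in> borel_measurable lborel" using f by auto
    have "emeasure (density lborel (\<lambda>y. ennreal (max 0 (f y)))) {x<..}
        = (\<integral>\<^sup>+y. ennreal (max 0 (f y) * indicator {x<..} y) \<partial>lborel)"
      by (subst emeasure_density)
         (auto simp: ennreal_mult'' ennreal_indicator[symmetric] intro!: nn_integral_cong split: split_indicator)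
    also have "\<dots> = ennreal (\<integral>y. max 0 (f y) * indicator {x<..} y \<partial>lborel)"
      by (rule nn_integral_eq_integral[OF pir[OF f]]) auto
    finally show ?thesis .
  qed
  have md: "integrable lborel (\<lambda>y. - d y)" using d by auto
  have ep: "emeasure (density lborel p) {x<..} = ennreal (\<integral>y. max 0 (d y) * indicator {x<..} y \<partial>lborel)"
    and en: "emeasure (density lborel n) {x<..} = ennreal (\<integral>y. max 0 (- d y) * indicator {x<..} y \<partial>lborel)" for x
    using dens[OF d] dens[OF md] unfolding p_def n_def by auto
  have "density lborel p = density lborel n"
  proof (rule measure_eqI_lessThan)
    show "emeasure (density lborel p) {x<..} = emeasure (density lborel n) {x<..}" for x
    proof -
      have "0 = (\<integral>y. d y * indicator {x<..} y \<partial>lborel)" using zero[of x] by (rule sym)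
      also have "\<dots> = (\<integral>y. max 0 (d y) * indicator {x<..} y - max 0 (- d y) * indicator {x<..} y \<partial>lborel)"
        by (rule Bochner_Integration.integral_cong) (auto split: split_indicator)
      also have "\<dots> = (\<integral>y. max 0 (d y) * indicator {x<..} y \<partial>lborel) - (\<integral>y. max 0 (- d y) * indicator {x<..} y \<partial>lborel)"
        by (rule Bochner_Integration.integral_diff[OF pir[OF d] pir[OF md]])
      finally show ?thesis unfolding ep en by simp
    qed
  qed (auto simp: ep)
  then have "AE x in lborel. p x = n x"
    by (subst (asm) sigma_finite_measure.density_unique_iff[OF sigma_finite_lborel]) auto
  then show ?thesis
    by eventually_elim (auto simp: p_def n_def max_def split: if_splits)
qed

text \<open>Extension by zero turns vanishing integrals over initial segments into vanishing
  integrals over rays, where the measure argument applies.\<close>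

lemma AE_eq_0_if_integrals_zero:
  fixes d :: "real \<Rightarrow> real"
  assumes d: "d absolutely_integrable_on {a..b}"
    and zero: "\<And>x. x \<in> {a..b} \<Longrightarrow> integral {a..x} d = 0"
  shows "AE x in lebesgue. x \<in> {a..b} \<longrightarrow> d x = 0"
proof (cases "a \<le> b")
  case True
  define e where "e x = indicator {a..b} x * d x" for x
  have ei: "integrable lebesgue e"
    using d by (simp add: set_integrable_def e_def[abs_def])
  \<comment> \<open>The measure argument concerns Borel functions, so a Borel representative stands
    in for \<open>e\<close>.\<close>
  obtain e' where e'm: "e' \<in> borel_measurable lborel" and ee': "AE x in lborel. e x = e' x"
    using completion_ex_borel_measurable_real[OF borel_measurable_integrable[OF ei]] by auto
  have aeL: "AE x in lebesgue. e x = e' x" using ee' by (rule AE_completion)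
  have e'L: "integrable lebesgue e'"
    using ei aeL e'm by (subst integrable_cong_AE[of e' _ e]) (auto intro: measurable_completion)
  then have e'i: "integrable lborel e'" using e'm by (simp add: integrable_completion)
  have "(\<integral>y. e' y * indicator {x<..} y \<partial>lborel) = 0" for x
  proof -
    have "(\<integral>y. e' y * indicator {x<..} y \<partial>lborel) = (\<integral>y. e' y * indicator {x<..} y \<partial>lebesgue)"
      using e'm by (subst integral_completion) auto
    also have "\<dots> = (\<integral>y. e y * indicator {x<..} y \<partial>lebesgue)"
    proof (rule Bochner_Integration.integral_cong_AE)
      show "(\<lambda>y. e' y * indicator {x<..} y) \<in> borel_measurable lebesgue"
        using e'm by (auto intro: measurable_completion)
      show "(\<lambda>y. e y * indicator {x<..} y) \<in> borel_measurable lebesgue"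
        by (intro borel_measurable_times borel_measurable_integrable[OF ei] borel_measurable_indicator) simp
      show "AE y in lebesgue. e' y * indicator {x<..} y = e y * indicator {x<..} y"
        using aeL by eventually_elim simp
    qed
    also have "\<dots> = (\<integral>y. indicator ({a..b} \<inter> {x<..}) y *\<^sub>R d y \<partial>lebesgue)"
      unfolding e_def by (rule Bochner_Integration.integral_cong) (auto split: split_indicator)
    also have "\<dots> = integral ({a..b} \<inter> {x<..}) d"
    proof -
      have "set_integrable lebesgue ({a..b} \<inter> {x<..}) d"
        by (rule set_integrable_subset[OF d]) auto
      from set_lebesgue_integral_eq_integral(2)[OF this] show ?thesis
        by (simp add: set_lebesgue_integral_def)
    qed
    also have "\<dots> = 0"
    proof -
      consider "x < a" | "x \<in> {a..b}" | "x > b" by fastforce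
      then show ?thesis
      proof cases
        case 1 then have "{a..b} \<inter> {x<..} = {a..b}" by auto
        then show ?thesis using zero[of b] True by simp
      next
        case 2
        then have eq: "{a..b} \<inter> {x<..} = {x<..b}" by auto
        have "integral {x<..b} d = integral {x..b} d"
          by (rule integral_spike_set) (auto intro: negligible_subset[of "{x}"])
        moreover have "integral {a..x} d + integral {x..b} d = integral {a..b} d"
          using 2 d absolutely_integrable_on_def by (intro Henstock_Kurzweil_Integration.integral_combine) auto
        ultimately show ?thesis unfolding eq using zero[of x] zero[of b] 2 True by simp
      next
        case 3 then have "{a..b} \<inter> {x<..} = {}" by auto
        then show ?thesis by simp
      qed
    qed
    finally show ?thesis .
  qed
  then have "AE x in lborel. e' x = 0" by (rule AE_eq_0_if_rays_lborel[OF e'i])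
  then have "AE x in lebesgue. e' x = 0" by (rule AE_completion)
  with aeL show ?thesis
    by eventually_elim (auto simp: e_def)
qed auto

lemma AE_eq_0_if_integrals_zero_ray:
  fixes d :: "real \<Rightarrow> real"
  assumes d: "\<And>x. d absolutely_integrable_on {a..x}"
    and zero: "\<And>x. x \<ge> a \<Longrightarrow> integral {a..x} d = 0"
  shows "AE x in lebesgue. x \<in> {a..} \<longrightarrow> d x = 0"
proof -
  have "AE x in lebesgue. x \<in> {a..a + real n} \<longrightarrow> d x = 0" for n
    by (rule AE_eq_0_if_integrals_zero[OF d]) (simp add: zero)
  then have "AE x in lebesgue. \<forall>n. x \<in> {a..a + real n} \<longrightarrow> d x = 0"
    by (simp only: AE_all_countable) simp
  then show ?thesis
  proof eventually_elim
    case (elim x)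
    show ?case
    proof
      assume x: "x \<in> {a..}"
      obtain n where "x - a \<le> real n" using real_arch_simple by blast
      then have "x \<in> {a..a + real n}" using x by simp
      with elim show "d x = 0" by blast
    qed
  qed
qed

section \<open>Square-integrable functions\<close>

lemma L2_halfline_iff:
  "f \<in> L2_halfline \<longleftrightarrow> f \<in> borel_measurable (lebesgue_on {0<..}) \<and>
     (\<lambda>x. (f x)\<^sup>2) absolutely_integrable_on {0<..}"
  unfolding L2_halfline_def set_borel_measurable_def
  by (auto simp: borel_measurable_restrict_space_iff)

lemma L2_mult_integrable:
  assumes "f \<in> L2_halfline" "g \<in> L2_halfline"
  shows "(\<lambda>x. f x * g x) absolutely_integrable_on {0<..}"
proof (rule measurable_bounded_by_integrable_imp_absolutely_integrable)
  show "(\<lambda>x. f x * g x) \<in> borel_measurable (lebesgue_on {0<..})"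
    using assms by (auto simp: L2_halfline_iff)
  show "(\<lambda>x. (f x)\<^sup>2 + (g x)\<^sup>2) integrable_on {0<..}"
    using assms by (auto simp: L2_halfline_iff absolutely_integrable_on_def intro!: integrable_add)
  show "norm (f x * g x) \<le> (f x)\<^sup>2 + (g x)\<^sup>2" for x
  proof -
    have "2 * (\<bar>f x\<bar> * \<bar>g x\<bar>) \<le> (f x)\<^sup>2 + (g x)\<^sup>2"
      using sum_squares_bound[of "\<bar>f x\<bar>" "\<bar>g x\<bar>"] by (simp add: mult.assoc)
    moreover have "0 \<le> \<bar>f x\<bar> * \<bar>g x\<bar>" by simp
    ultimately show ?thesis unfolding real_norm_def abs_mult by linarith
  qed
qed simp

lemma L2_cmult: "f \<in> L2_halfline \<Longrightarrow> (\<lambda>x. c * f x) \<in> L2_halfline"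
  by (auto simp: L2_halfline_iff power_mult_distrib)

lemma L2_add:
  assumes "f \<in> L2_halfline" "g \<in> L2_halfline"
  shows "(\<lambda>x. f x + g x) \<in> L2_halfline"
proof -
  have "(\<lambda>x. ((f x)\<^sup>2 + (g x)\<^sup>2) + 2 * (f x * g x)) absolutely_integrable_on {0<..}"
    using assms L2_mult_integrable[OF assms]
    by (intro set_integral_add(1) set_integrable_mult_right) (auto simp: L2_halfline_iff)
  moreover have "((f x)\<^sup>2 + (g x)\<^sup>2) + 2 * (f x * g x) = (f x + g x)\<^sup>2" for x
    by (simp add: power2_sum)
  ultimately show ?thesis
    using assms by (auto simp: L2_halfline_iff)
qed

lemma L2_local_integrable:
  assumes f: "f \<in> L2_halfline" and "0 \<le> a"
  shows "f absolutely_integrable_on {a..b}"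
proof -
  \<comment> \<open>\<open>f\<close> is controlled on the open half-line only; the open interval
    admits \<open>a = 0\<close>, and its end points are added as a null set.\<close>
  have "f absolutely_integrable_on {a<..<b}"
  proof (rule measurable_bounded_by_integrable_imp_absolutely_integrable)
    show "f \<in> borel_measurable (lebesgue_on {a<..<b})"
      by (rule measurable_restrict_mono) (use assms in \<open>auto simp: L2_halfline_iff\<close>)
    show "(\<lambda>x. 1 + (f x)\<^sup>2) integrable_on {a<..<b}"
    proof (rule integrable_add)
      show "(\<lambda>x. 1) integrable_on {a<..<b}"
        using integrable_on_const[of "{a<..<b}" 1] by (simp add: fmeasurable_box lmeasurable_interval)
      have "(\<lambda>x. (f x)\<^sup>2) absolutely_integrable_on {a<..<b}"
        by (rule set_integrable_subset[of _ "{0<..}"]) (use assms in \<open>auto simp: L2_halfline_iff\<close>)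
      then show "(\<lambda>x. (f x)\<^sup>2) integrable_on {a<..<b}" by (simp add: absolutely_integrable_on_def)
    qed
    show "norm (f x) \<le> 1 + (f x)\<^sup>2" for x
    proof -
      have "0 \<le> (\<bar>f x\<bar> - 1/2)\<^sup>2" by simp
      then show ?thesis by (simp add: power2_eq_square algebra_simps)
    qed
  qed simp
  then show ?thesis by (simp add: absolutely_integrable_on_Icc_iff_Ioo)
qed

section \<open>Sobolev functions as primitives\<close>

text \<open>\<open>f\<close> is the absolutely continuous representative and \<open>g\<close> an
  explicit version of its derivative. Carrying \<open>g\<close> along makes linear combinations easy
  to follow, which the choice operator inside \<open>weak_deriv\<close> would prevent.\<close>

definition sobolev :: "(real \<Rightarrow> real) \<Rightarrow> (real \<Rightarrow> real) \<Rightarrow> bool" where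
  "sobolev f g \<longleftrightarrow> f \<in> L2_halfline \<and> g \<in> L2_halfline \<and> (\<forall>x\<ge>0. integral {0..x} g = f x - f 0)"

lemma sobolevD:
  assumes "sobolev f g"
  shows "f \<in> L2_halfline" "g \<in> L2_halfline" "\<And>x. x \<ge> 0 \<Longrightarrow> integral {0..x} g = f x - f 0"
  using assms unfolding sobolev_def by blast+

lemma sobolev_increment:
  assumes "sobolev f g" "0 \<le> s" "s \<le> t"
  shows "integral {s..t} g = f t - f s"
proof -
  have "integral {0..s} g + integral {s..t} g = integral {0..t} g"
    using L2_local_integrable[OF sobolevD(2)[OF assms(1)], of 0 t] assms absolutely_integrable_on_def
    by (intro Henstock_Kurzweil_Integration.integral_combine) auto
  then show ?thesis using sobolevD(3)[OF assms(1), of s] sobolevD(3)[OF assms(1), of t] assms by linarith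
qed

lemma sobolev_continuous:
  assumes "sobolev f g"
  shows "continuous_on {0..} f"
proof -
  have c: "continuous_on {0..b} f" for b
    by (rule continuous_on_antiderivative[OF L2_local_integrable[OF sobolevD(2)[OF assms]]])
       (use sobolevD(3)[OF assms] in auto)
  show ?thesis
    unfolding continuous_on_eq_continuous_within
  proof
    fix x :: real assume x: "x \<in> {0..}"
    have "continuous (at x within {0..x+1}) f"
      using c[of "x+1"] x by (simp add: continuous_on_eq_continuous_within)
    moreover have "at x within {0..x+1} = at x within {0..}"
      by (rule at_within_nhd[of _ "{..<x+1}"]) auto
    ultimately show "continuous (at x within {0..}) f" by simp
  qed
qed


lemma set_integral_eq_integral_support:
  fixes F :: "real \<Rightarrow> real"
  assumes "F absolutely_integrable_on {s..t}" "0 < s" "\<And>x. x \<notin> {s..t} \<Longrightarrow> F x = 0"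
  shows "(LINT x:{0<..}|lebesgue. F x) = integral {s..t} F"
proof -
  have "(LINT x:{0<..}|lebesgue. F x) = (LINT x:{s..t}|lebesgue. F x)"
    unfolding set_lebesgue_integral_def
  proof (rule Bochner_Integration.integral_cong)
    show "indicat_real {0<..} x *\<^sub>R F x = indicat_real {s..t} x *\<^sub>R F x" for x
      using assms(2) assms(3)[of x] by (cases "x \<in> {s..t}") auto
  qed simp
  then show ?thesis using set_lebesgue_integral_eq_integral(2)[OF assms(1)] by simp
qed

lemma integral_continuous_derivative:
  fixes \<phi> \<phi>' :: "real \<Rightarrow> real"
  assumes "\<And>x. x \<in> {a..b} \<Longrightarrow> (\<phi> has_real_derivative \<phi>' x) (at x)" "a \<le> b"
  shows "integral {a..b} \<phi>' = \<phi> b - \<phi> a"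
  by (rule integral_unique, rule fundamental_theorem_of_calculus)
     (use assms in \<open>auto simp: has_real_derivative_iff_has_vector_derivative[symmetric] intro: has_field_derivative_at_within\<close>)

text \<open>By the product rule, \<open>f\<close> minus a primitive of \<open>g\<close> is weakly
  constant on \<open>{s..t+1}\<close> for \<open>0 < s\<close>, hence takes equal values at
  \<open>s\<close> and \<open>t\<close>. Test functions never reach \<open>0\<close>; the boundary
  value enters by continuity of \<open>f\<close> as \<open>s\<close> tends to
  \<open>0\<close>.\<close>

lemma weak_derivative_imp_sobolev:
  assumes f: "f \<in> L2_halfline" "continuous_on {0..} f" and g: "g \<in> L2_halfline"
    and weak: "has_weak_derivative f g"
  shows "sobolev f g"
proof -
  have gi: "g absolutely_integrable_on {s..t}" if "0 \<le> s" for s t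
    using L2_local_integrable[OF g that] .
  have gi': "g integrable_on {s..t}" if "0 \<le> s" for s t
    using gi[OF that] absolutely_integrable_on_def by blast
  have inc: "f s = f t - integral {s..t} g" if st: "0 < s" "s < t" for s t
  proof -
    define r where "r x = f x - integral {s..x} g" for x
    have cf: "continuous_on {s..t+1} f" by (rule continuous_on_subset[OF f(2)]) (use st in auto)
    have cG: "continuous_on {s..t+1} (\<lambda>x. integral {s..x} g)"
      using gi' st by (intro indefinite_integral_continuous_1) auto
    have cr: "continuous_on {s..t+1} r" unfolding r_def by (intro continuous_intros cf cG)
    have "r s = r t"
    proof (rule weakly_constant_imp_constant[OF st cr])
      fix \<phi> assume \<phi>: "\<phi> \<in> test_functions" "continuous_on UNIV (deriv \<phi>)"
        "\<And>x. (\<phi> has_real_derivative deriv \<phi> x) (at x)"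
        "\<And>x. x \<notin> {s<..<t+1} \<Longrightarrow> \<phi> x = 0" "\<And>x. x \<notin> {s<..<t+1} \<Longrightarrow> deriv \<phi> x = 0"
      have cd: "continuous_on {s..t+1} (deriv \<phi>)" using \<phi>(2) continuous_on_subset by blast
      have c\<phi>: "continuous_on {s..t+1} \<phi>"
        using \<phi>(3) by (intro continuous_at_imp_continuous_on ballI DERIV_isCont) auto
      have di: "deriv \<phi> absolutely_integrable_on {s..t+1}"
        using absolutely_integrable_continuous_real[OF cd] .
      have i1: "(\<lambda>x. f x * deriv \<phi> x) absolutely_integrable_on {s..t+1}"
        by (intro absolutely_integrable_continuous_real continuous_intros cf cd)
      have i2: "(\<lambda>x. g x * \<phi> x) absolutely_integrable_on {s..t+1}"
        using absolutely_integrable_continuous_mult(2)[OF c\<phi> gi] st by simp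
      have i3: "(\<lambda>x. integral {s..x} g * deriv \<phi> x) absolutely_integrable_on {s..t+1}"
        by (intro absolutely_integrable_continuous_real continuous_intros cG cd)
      have e1: "(LINT x:{0<..}|lebesgue. f x * deriv \<phi> x) = integral {s..t+1} (\<lambda>x. f x * deriv \<phi> x)"
        by (rule set_integral_eq_integral_support[OF i1 st(1)]) (use \<phi>(5) in auto)
      have e2: "(LINT x:{0<..}|lebesgue. g x * \<phi> x) = integral {s..t+1} (\<lambda>x. g x * \<phi> x)"
        by (rule set_integral_eq_integral_support[OF i2 st(1)]) (use \<phi>(4) in auto)
      have "integral {s..t+1} (\<lambda>x. g x * \<phi> x + integral {s..x} g * deriv \<phi> x) =
          integral {s..t+1} g * \<phi> (t+1) - integral {s..s} g * \<phi> s"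
        using st \<phi>(3)
        by (intro antiderivative_mult(2)) (auto intro!: gi di integral_continuous_derivative)
      also have "\<dots> = 0" using \<phi>(4)[of "t+1"] by simp
      finally have "integral {s..t+1} (\<lambda>x. g x * \<phi> x) + integral {s..t+1} (\<lambda>x. integral {s..x} g * deriv \<phi> x) = 0"
        using i2 i3 by (subst (asm) Henstock_Kurzweil_Integration.integral_add) (auto simp: absolutely_integrable_on_def)
      moreover have "integral {s..t+1} (\<lambda>x. f x * deriv \<phi> x) = - integral {s..t+1} (\<lambda>x. g x * \<phi> x)"
        using weak \<phi>(1) e1 e2 unfolding has_weak_derivative_def by metis
      ultimately have "integral {s..t+1} (\<lambda>x. f x * deriv \<phi> x) - integral {s..t+1} (\<lambda>x. integral {s..x} g * deriv \<phi> x) = 0"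
        by linarith
      then show "integral {s..t+1} (\<lambda>x. r x * deriv \<phi> x) = 0"
        using i1 i3 unfolding r_def left_diff_distrib
        by (subst Henstock_Kurzweil_Integration.integral_diff) (auto simp: absolutely_integrable_on_def)
    qed
    then show ?thesis unfolding r_def by simp
  qed
  have "integral {0..t} g = f t - f 0" if "t \<ge> 0" for t
  proof (cases "t = 0")
    case False
    with that have t: "t > 0" by simp
    define D where "D s = f s - integral {0..s} g" for s
    have cD: "continuous_on {0..t} D"
      unfolding D_def using gi'
      by (intro continuous_intros indefinite_integral_continuous_1 continuous_on_subset[OF f(2)]) auto
    have "D s = D t" if "s \<in> {0<..<t}" for s
    proof -
      have "integral {0..s} g + integral {s..t} g = integral {0..t} g"
        using that gi' by (intro Henstock_Kurzweil_Integration.integral_combine) auto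
      then show ?thesis using inc[of s t] that unfolding D_def by auto
    qed
    then have "D 0 = D t"
      using continuous_constant_on_closure[of "{0<..<t}" D "D t" 0] cD t by simp
    then show ?thesis unfolding D_def by simp
  qed simp
  then show ?thesis using f g unfolding sobolev_def by blast
qed

text \<open>The converse direction, through which sums and multiples of admissible functions are
  recognised as elements of \<open>H1_halfline\<close>.\<close>

lemma sobolev_imp_weak_derivative:
  assumes "sobolev f g"
  shows "has_weak_derivative f g"
  unfolding has_weak_derivative_def
proof
  note f = sobolevD[OF assms]
  fix \<phi> assume "\<phi> \<in> test_functions"
  then have C1: "\<phi> C1_differentiable_on UNIV" and cpt: "compact (closure {x. \<phi> x \<noteq> 0})"
    and sub: "closure {x. \<phi> x \<noteq> 0} \<subseteq> {0<..}"
    unfolding test_functions_def by auto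
  obtain D where D: "\<And>x. (\<phi> has_real_derivative D x) (at x)" "continuous_on UNIV D"
    using C1 unfolding C1_differentiable_on_def has_real_derivative_iff_has_vector_derivative by blast
  have dD: "deriv \<phi> = D" using D(1) DERIV_imp_deriv by blast
  obtain s t where st: "0 < s" "s \<le> t" "\<And>x. x \<notin> {s..t} \<Longrightarrow> x \<notin> closure {x. \<phi> x \<noteq> 0}"
  proof (cases "closure {x. \<phi> x \<noteq> 0} = {}")
    case True
    show ?thesis by (rule that[of 1 1]) (simp_all add: True)
  next
    case False
    obtain a where a: "a \<in> closure {x. \<phi> x \<noteq> 0}" "\<And>y. y \<in> closure {x. \<phi> x \<noteq> 0} \<Longrightarrow> a \<le> y"
      using compact_attains_inf[OF cpt False] by blast
    obtain b where b: "b \<in> closure {x. \<phi> x \<noteq> 0}" "\<And>y. y \<in> closure {x. \<phi> x \<noteq> 0} \<Longrightarrow> y \<le> b"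
      using compact_attains_sup[OF cpt False] by blast
    show ?thesis
      by (rule that[of a b]) (use a b sub in \<open>auto simp: subset_eq\<close>)
  qed
  have \<phi>0: "\<phi> x = 0" if "x \<notin> {s..t}" for x
    using st(3)[OF that] closure_subset[of "{x. \<phi> x \<noteq> 0}"] by auto
  have d0: "deriv \<phi> x = 0" if "x \<notin> {s..t}" for x
  proof -
    have "((\<lambda>x. 0) has_real_derivative 0) (at x)" by simp
    then have "(\<phi> has_real_derivative 0) (at x)"
      by (rule has_field_derivative_transform_within_open[of _ _ _ "- {s..t}"])
         (use that \<phi>0 in \<open>auto simp: open_Compl\<close>)
    then show ?thesis by (rule DERIV_imp_deriv)
  qed
  have cd: "continuous_on S (deriv \<phi>)" for S using D(2) dD continuous_on_subset by blast
  have c\<phi>: "continuous_on S \<phi>" for S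
    using D(1) by (intro continuous_at_imp_continuous_on ballI DERIV_isCont) auto
  \<comment> \<open>Both points lie strictly outside the support, so the boundary terms of the
    integration by parts vanish.\<close>
  define a b where "a = s / 2" and "b = t + 1"
  have ab: "0 < a" "a \<le> b" "a < s" "t < b" using st unfolding a_def b_def by auto
  have cf: "continuous_on {a..b} f" by (rule continuous_on_subset[OF sobolev_continuous[OF assms]]) (use ab in auto)
  have gi: "g absolutely_integrable_on {a..b}" using L2_local_integrable[OF f(2)] ab by simp
  have i1: "(\<lambda>x. f x * deriv \<phi> x) absolutely_integrable_on {a..b}"
    by (intro absolutely_integrable_continuous_real continuous_intros cf cd)
  have i2: "(\<lambda>x. g x * \<phi> x) absolutely_integrable_on {a..b}"
    using absolutely_integrable_continuous_mult(2)[OF c\<phi> gi] .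
  have e1: "(LINT x:{0<..}|lebesgue. f x * deriv \<phi> x) = integral {a..b} (\<lambda>x. f x * deriv \<phi> x)"
    by (rule set_integral_eq_integral_support[OF i1 ab(1)]) (use d0 ab in auto)
  have e2: "(LINT x:{0<..}|lebesgue. g x * \<phi> x) = integral {a..b} (\<lambda>x. g x * \<phi> x)"
    by (rule set_integral_eq_integral_support[OF i2 ab(1)]) (use \<phi>0 ab in auto)
  have "integral {a..b} (\<lambda>x. g x * \<phi> x + f x * deriv \<phi> x) = f b * \<phi> b - f a * \<phi> a"
    using ab D(1) dD
    by (intro antiderivative_mult(2))
       (auto intro!: gi absolutely_integrable_continuous_real cd integral_continuous_derivative sobolev_increment[OF assms])
  also have "\<dots> = 0" using \<phi>0[of a] \<phi>0[of b] ab by simp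
  finally have "integral {a..b} (\<lambda>x. g x * \<phi> x) + integral {a..b} (\<lambda>x. f x * deriv \<phi> x) = 0"
    using i1 i2 by (subst (asm) Henstock_Kurzweil_Integration.integral_add) (auto simp: absolutely_integrable_on_def)
  then show "(LINT x:{0<..}|lebesgue. f x * deriv \<phi> x) = - (LINT x:{0<..}|lebesgue. g x * \<phi> x)"
    using e1 e2 by linarith
qed

lemma sobolev_AE_unique:
  assumes "sobolev f g1" "sobolev f g2"
  shows "AE x in lebesgue. x > 0 \<longrightarrow> g1 x = g2 x"
proof -
  have i: "g1 absolutely_integrable_on {0..x}" "g2 absolutely_integrable_on {0..x}" for x
    using assms[THEN sobolevD(2)] by (auto intro: L2_local_integrable)
  have "AE x in lebesgue. x \<in> {0..} \<longrightarrow> g1 x - g2 x = 0"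
  proof (rule AE_eq_0_if_integrals_zero_ray)
    show "(\<lambda>x. g1 x - g2 x) absolutely_integrable_on {0..x}" for x
      using i by (intro set_integral_diff(1))
    show "integral {0..x} (\<lambda>x. g1 x - g2 x) = 0" if "x \<ge> 0" for x
      using i[of x] sobolevD(3)[OF assms(1) that] sobolevD(3)[OF assms(2) that]
      by (subst Henstock_Kurzweil_Integration.integral_diff) (auto simp: absolutely_integrable_on_def)
  qed
  then show ?thesis by eventually_elim auto
qed

lemma H1_halfline_imp_sobolev:
  assumes "f \<in> H1_halfline"
  shows "sobolev f (weak_deriv f)"
proof -
  have ex: "\<exists>g. g \<in> L2_halfline \<and> has_weak_derivative f g"
    using assms unfolding H1_halfline_def by blast
  have "weak_deriv f \<in> L2_halfline \<and> has_weak_derivative f (weak_deriv f)"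
    unfolding weak_deriv_def by (rule someI_ex[OF ex])
  then show ?thesis
    using assms weak_derivative_imp_sobolev unfolding H1_halfline_def by blast
qed

text \<open>Under an integral, \<open>weak_deriv f\<close> may thus be replaced by any version
  \<open>g\<close> at hand.\<close>

lemma sobolev_imp_H1_halfline:
  assumes "sobolev f g"
  shows "f \<in> H1_halfline" "AE x in lebesgue. x > 0 \<longrightarrow> weak_deriv f x = g x"
proof -
  show f: "f \<in> H1_halfline"
    using sobolevD[OF assms] sobolev_continuous[OF assms] sobolev_imp_weak_derivative[OF assms]
    unfolding H1_halfline_def by blast
  show "AE x in lebesgue. x > 0 \<longrightarrow> weak_deriv f x = g x"
    by (rule sobolev_AE_unique[OF H1_halfline_imp_sobolev[OF f] assms])
qed

lemma sobolev_add:
  assumes "sobolev f1 g1" "sobolev f2 g2"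
  shows "sobolev (\<lambda>x. f1 x + f2 x) (\<lambda>x. g1 x + g2 x)"
  unfolding sobolev_def
proof (intro conjI allI impI)
  show "integral {0..x} (\<lambda>x. g1 x + g2 x) = f1 x + f2 x - (f1 0 + f2 0)" if "0 \<le> x" for x
    using sobolevD(3)[OF assms(1) that] sobolevD(3)[OF assms(2) that]
      L2_local_integrable[OF sobolevD(2)[OF assms(1)], of 0 x]
      L2_local_integrable[OF sobolevD(2)[OF assms(2)], of 0 x]
    by (subst Henstock_Kurzweil_Integration.integral_add) (auto simp: absolutely_integrable_on_def)
qed (use assms[THEN sobolevD(1)] assms[THEN sobolevD(2)] in \<open>auto intro: L2_add\<close>)

lemma sobolev_cmult:
  assumes "sobolev f g"
  shows "sobolev (\<lambda>x. c * f x) (\<lambda>x. c * g x)"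
  unfolding sobolev_def
proof (intro conjI allI impI)
  show "integral {0..x} (\<lambda>x. c * g x) = c * f x - c * f 0" if "0 \<le> x" for x
    using sobolevD(3)[OF assms that] by (simp add: right_diff_distrib)
qed (use sobolevD[OF assms] in \<open>auto intro: L2_cmult\<close>)

text \<open>The derivative of \<open>f^2\<close> is \<open>2 * f * g\<close>, integrable as a
  product of two square-integrable functions; this bounds \<open>f^2\<close> by its value at
  \<open>0\<close> plus twice the integral of |f g|.\<close>

lemma sobolev_bounded:
  assumes "sobolev f g"
  obtains B where "B \<ge> 0" "\<And>x. x \<ge> 0 \<Longrightarrow> \<bar>f x\<bar> \<le> B"
proof -
  define C where "C = integral {0<..} (\<lambda>x. \<bar>f x * g x\<bar>)"
  note f = sobolevD[OF assms]
  have fg: "(\<lambda>x. f x * g x) absolutely_integrable_on {0<..}" by (rule L2_mult_integrable[OF f(1,2)])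
  then have fga: "(\<lambda>x. \<bar>f x * g x\<bar>) integrable_on {0<..}" by (simp add: absolutely_integrable_on_def)
  have sq: "(f x)\<^sup>2 \<le> (f 0)\<^sup>2 + 2 * C" if "x \<ge> 0" for x
  proof -
    have gi: "g absolutely_integrable_on {0..x}" using L2_local_integrable[OF f(2)] by simp
    have inc: "integral {0..y} g = f y - f 0" if "y \<in> {0..x}" for y using f(3) that by simp
    have "integral {0..x} (\<lambda>x. g x * f x + f x * g x) = f x * f x - f 0 * f 0"
      by (rule antiderivative_mult(2)[OF that gi gi inc inc])
    moreover have "integral {0..x} (\<lambda>x. g x * f x + f x * g x) = 2 * integral {0..x} (\<lambda>x. f x * g x)"
      by (subst Henstock_Kurzweil_Integration.integral_mult_right[symmetric]) (simp add: algebra_simps)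
    moreover have "integral {0..x} (\<lambda>x. f x * g x) \<le> C"
    proof -
      have eq: "integral {0..x} (\<lambda>x. f x * g x) = integral {0<..x} (\<lambda>x. f x * g x)"
        by (rule integral_spike_set) (auto intro: negligible_subset[of "{0}"])
      have s: "(\<lambda>x. f x * g x) absolutely_integrable_on {0<..x}"
        by (rule set_integrable_subset[OF fg]) auto
      have "integral {0<..x} (\<lambda>x. f x * g x) \<le> integral {0<..x} (\<lambda>x. \<bar>f x * g x\<bar>)"
        by (rule integral_le) (use s in \<open>auto simp: absolutely_integrable_on_def\<close>)
      also have "\<dots> \<le> C"
        unfolding C_def by (rule integral_subset_le) (use s fga in \<open>auto simp: absolutely_integrable_on_def\<close>)
      finally show ?thesis using eq by simp
    qed
    ultimately show ?thesis by (simp add: power2_eq_square)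
  qed
  show ?thesis
  proof (rule that)
    show "sqrt ((f 0)\<^sup>2 + 2 * C) \<ge> 0" using sq[of 0] by (simp add: order_trans[OF zero_le_power2])
    show "\<bar>f x\<bar> \<le> sqrt ((f 0)\<^sup>2 + 2 * C)" if "x \<ge> 0" for x
      using sq[OF that] real_le_rsqrt[of "\<bar>f x\<bar>"] by simp
  qed
qed


section \<open>Regularity of weak solutions\<close>

lemma L2_restrict:
  assumes "f \<in> L2_halfline"
  shows "(\<lambda>x. if x \<in> {s..t} then f x else 0) \<in> L2_halfline"
proof -
  have m: "f \<in> borel_measurable (lebesgue_on {0<..})" and i: "(\<lambda>x. (f x)\<^sup>2) absolutely_integrable_on {0<..}"
    using assms by (auto simp: L2_halfline_iff)
  have [measurable]: "(\<lambda>x::real. x) \<in> borel_measurable (lebesgue_on {0<..})"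
    by (rule continuous_imp_measurable_on_sets_lebesgue) auto
  have "(\<lambda>x. if x \<in> {s..t} then f x else 0) \<in> borel_measurable (lebesgue_on {0<..})"
    using m by measurable
  moreover have "(\<lambda>x. (if x \<in> {s..t} then f x else 0)\<^sup>2) absolutely_integrable_on {0<..}"
  proof (rule measurable_bounded_by_integrable_imp_absolutely_integrable)
    show "(\<lambda>x. (if x \<in> {s..t} then f x else 0)\<^sup>2) \<in> borel_measurable (lebesgue_on {0<..})"
      using m by measurable
    show "(\<lambda>x. (f x)\<^sup>2) integrable_on {0<..}" using i by (simp add: absolutely_integrable_on_def)
  qed auto
  ultimately show ?thesis by (simp add: L2_halfline_iff)
qed

lemma L2_continuous_restrict:
  assumes f: "continuous_on {s..t} f" and "0 < s"
  shows "(\<lambda>x. if x \<in> {s..t} then f x else 0) \<in> L2_halfline"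
proof -
  have a: "(\<lambda>x. if x \<in> {s..t} then h x else 0) absolutely_integrable_on {0<..}"
    if "continuous_on {s..t} h" for h :: "real \<Rightarrow> real"
  proof -
    have h: "h absolutely_integrable_on {s..t}" using that by (rule absolutely_integrable_continuous_real)
    have "(\<lambda>x. if x \<in> {s..t} then h x else 0) absolutely_integrable_on UNIV"
      using h by (simp only: absolutely_integrable_restrict_UNIV)
    then show ?thesis by (rule set_integrable_subset) auto
  qed
  have "(\<lambda>x. if x \<in> {s..t} then f x else 0) \<in> borel_measurable (lebesgue_on {0<..})"
    by (rule absolutely_integrable_imp_borel_measurable[OF a[OF f]]) simp
  moreover have "(\<lambda>x. (if x \<in> {s..t} then f x else 0)\<^sup>2) = (\<lambda>x. if x \<in> {s..t} then (f x)\<^sup>2 else 0)"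
    by auto
  moreover have "\<dots> absolutely_integrable_on {0<..}"
    by (rule a) (intro continuous_intros f)
  ultimately show ?thesis by (simp add: L2_halfline_iff)
qed

lemma L2_square_integrable_Icc:
  assumes "f \<in> L2_halfline" "0 \<le> a"
  shows "(\<lambda>x. (f x)\<^sup>2) absolutely_integrable_on {a..b}"
proof -
  have "(\<lambda>x. (f x)\<^sup>2) absolutely_integrable_on {a<..<b}"
    by (rule set_integrable_subset[of _ "{0<..}"]) (use assms in \<open>auto simp: L2_halfline_iff\<close>)
  then show ?thesis by (simp only: absolutely_integrable_on_Icc_iff_Ioo)
qed

text \<open>Cauchy-Schwarz against the constant 1, from the nonnegative integral of
  \<open>(r - c)^2\<close> with \<open>c\<close> the mean of \<open>r\<close>.\<close>

lemma integral_squared_le: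
  fixes r :: "real \<Rightarrow> real"
  assumes "r integrable_on {a..b}" "(\<lambda>x. (r x)\<^sup>2) integrable_on {a..b}" "a \<le> b"
  shows "(integral {a..b} r)\<^sup>2 \<le> (b - a) * integral {a..b} (\<lambda>x. (r x)\<^sup>2)"
proof (cases "a = b")
  case False
  define I J where "I = integral {a..b} r" and "J = integral {a..b} (\<lambda>x. (r x)\<^sup>2)"
  define c where "c = I / (b - a)"
  have ba: "b - a > 0" using assms False by simp
  have hc: "((\<lambda>x. c\<^sup>2) has_integral (b - a) *\<^sub>R c\<^sup>2) {a..b}"
    using has_integral_const_real[of "c\<^sup>2" a b] assms by simp
  have "((\<lambda>x. ((r x)\<^sup>2 - (2 * c) * r x) + c\<^sup>2) has_integral ((J - (2 * c) * I) + (b - a) *\<^sub>R c\<^sup>2)) {a..b}"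
    unfolding I_def J_def using assms
    by (intro has_integral_add has_integral_diff has_integral_mult_right integrable_integral hc)
  moreover have "0 \<le> ((r x)\<^sup>2 - (2 * c) * r x) + c\<^sup>2" for x
    using zero_le_power2[of "r x - c"] unfolding power2_diff by (simp only: mult_ac)
  ultimately have "0 \<le> (J - (2 * c) * I) + (b - a) *\<^sub>R c\<^sup>2"
    by (rule has_integral_nonneg) 
  then have "0 \<le> (b - a) * ((J - (2 * c) * I) + (b - a) * c\<^sup>2)" using ba by simp
  also have "\<dots> = (b - a) * J - 2 * (c * (b - a)) * I + (c * (b - a))\<^sup>2"
    by (simp add: algebra_simps power2_eq_square)
  also have "c * (b - a) = I" unfolding c_def using ba by simp
  also have "(b - a) * J - 2 * I * I + I\<^sup>2 = (b - a) * J - I\<^sup>2" by (simp add: power2_eq_square)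
  finally show ?thesis unfolding I_def J_def by simp
qed simp

lemma has_real_derivative_indefinite_integral:
  fixes h :: "real \<Rightarrow> real"
  assumes "continuous_on {s..t} h" "x \<in> {s<..<t}"
  shows "((\<lambda>x. integral {s..x} h) has_real_derivative h x) (at x)"
proof -
  have "((\<lambda>x. integral {s..x} h) has_real_derivative h x) (at x within {s..t})"
    by (rule integral_has_real_derivative) (use assms in auto)
  moreover have "at x within {s..t} = at x"
    by (rule at_within_interior) (use assms in auto)
  ultimately show ?thesis by simp
qed

text \<open>
  The test function is \<open>R\<close>, the primitive of \<open>r = u' - W - c\<close> on \<open>[s,t]\<close>, where \<open>W' = V u / e\<^sup>2\<close> and
  the constant \<open>c\<close> makes \<open>R t = 0\<close>; the weak equation then says that \<open>r\<^sup>2\<close> has integral zero.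
\<close>

lemma weak_solution_local_regularity:
  assumes e: "e > (0::real)" and u: "sobolev u g" and V: "continuous_on {0..} V"
    and weak: "\<And>\<eta> \<kappa>. sobolev \<eta> \<kappa> \<Longrightarrow> (\<lambda>x. \<bar>x\<bar> * \<eta> x) \<in> L2_halfline \<Longrightarrow> \<eta> 0 = 0 \<Longrightarrow>
        integral {0<..} (\<lambda>x. e\<^sup>2 * (g x * \<kappa> x) + V x * (u x * \<eta> x)) = 0"
    and st: "0 < s" "s < t"
  shows "\<exists>u1. \<forall>x\<in>{s<..<t}. (u has_real_derivative u1 x) (at x) \<and>
      (u1 has_real_derivative V x * u x / e\<^sup>2) (at x)"
proof -
  define w where "w x = V x * u x / e\<^sup>2" for x
  define W where "W x = integral {s..x} w" for x
  define c where "c = (integral {s..t} (\<lambda>x. g x - W x)) / (t - s)"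
  define r where "r x = g x - (W x + c)" for x
  define R where "R x = integral {s..x} r" for x
  define \<kappa> where "\<kappa> x = (if x \<in> {s..t} then r x else 0)" for x
  define \<eta> where "\<eta> x = (if x \<in> {s..t} then R x else 0)" for x
  have cw: "continuous_on {s..t} w"
    unfolding w_def using e st
    by (intro continuous_intros continuous_on_subset[OF V] continuous_on_subset[OF sobolev_continuous[OF u]]) auto
  have wi: "w absolutely_integrable_on {s..t}" using cw by (rule absolutely_integrable_continuous_real)
  have cW: "continuous_on {s..t} W"
    unfolding W_def using cw by (intro indefinite_integral_continuous_1 integrable_continuous_real)
  have gi: "g absolutely_integrable_on {s..t}"
    using L2_local_integrable[OF sobolevD(2)[OF u]] st by simp
  have Wi: "W absolutely_integrable_on {s..t}" using cW by (rule absolutely_integrable_continuous_real)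
  have Wci: "(\<lambda>x. W x + c) absolutely_integrable_on {s..t}"
    using cW by (intro absolutely_integrable_continuous_real continuous_intros)
  have ri: "r absolutely_integrable_on {s..t}" unfolding r_def using gi Wci by (rule set_integral_diff(1))
  have cR: "continuous_on {s..t} R"
    unfolding R_def using ri by (intro indefinite_integral_continuous_1) (simp add: absolutely_integrable_on_def)
  have Rs: "R s = 0" unfolding R_def by simp
  have Rt: "R t = 0"
  proof -
    have "R t = integral {s..t} (\<lambda>x. (g x - W x) - c)" unfolding R_def r_def by (simp add: diff_diff_eq)
    also have "\<dots> = integral {s..t} (\<lambda>x. g x - W x) - integral {s..t} (\<lambda>x. c)"
      using gi Wi by (intro Henstock_Kurzweil_Integration.integral_diff integrable_diff) (auto simp: absolutely_integrable_on_def)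
    also have "\<dots> = 0" unfolding c_def using st by simp
    finally show ?thesis .
  qed
  have \<kappa>L2: "\<kappa> \<in> L2_halfline"
  proof -
    have "(\<lambda>x. (if x \<in> {s..t} then g x else 0) + (-1) * (if x \<in> {s..t} then W x + c else 0)) \<in> L2_halfline"
      using st by (intro L2_add L2_cmult L2_restrict L2_continuous_restrict continuous_intros cW sobolevD(2)[OF u])
    moreover have "(\<lambda>x. (if x \<in> {s..t} then g x else 0) + (-1) * (if x \<in> {s..t} then W x + c else 0)) = \<kappa>"
      by (auto simp: \<kappa>_def r_def)
    ultimately show ?thesis by simp
  qed
  have \<eta>L2: "\<eta> \<in> L2_halfline"
    unfolding \<eta>_def[abs_def] using cR st by (intro L2_continuous_restrict)
  have x\<eta>L2: "(\<lambda>x. \<bar>x\<bar> * \<eta> x) \<in> L2_halfline"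
  proof -
    have "(\<lambda>x. \<bar>x\<bar> * \<eta> x) = (\<lambda>x. if x \<in> {s..t} then \<bar>x\<bar> * R x else 0)" by (auto simp: \<eta>_def)
    moreover have "\<dots> \<in> L2_halfline" using st by (intro L2_continuous_restrict continuous_intros cR)
    ultimately show ?thesis by simp
  qed
  have \<eta>0: "\<eta> 0 = 0" using st by (simp add: \<eta>_def)
  have sob: "sobolev \<eta> \<kappa>"
    unfolding sobolev_def
  proof (intro conjI allI impI \<eta>L2 \<kappa>L2)
    fix x :: real assume "0 \<le> x"
    have "integral {0..x} \<kappa> = integral ({0..x} \<inter> {s..t}) r"
      unfolding \<kappa>_def[abs_def] by (subst Int_commute, rule Henstock_Kurzweil_Integration.integral_restrict_Int)
    also have "\<dots> = \<eta> x"
    proof -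
      consider "x < s" | "x \<in> {s..t}" | "x > t" by fastforce
      then show ?thesis
      proof cases
        case 1 then have "{0..x} \<inter> {s..t} = {}" by auto
        then show ?thesis using 1 by (simp add: \<eta>_def)
      next
        case 2 then have eq: "{0..x} \<inter> {s..t} = {s..x}" using st by auto
        show ?thesis unfolding eq using 2 by (simp add: \<eta>_def R_def)
      next
        case 3 then have eq: "{0..x} \<inter> {s..t} = {s..t}" using st by auto
        show ?thesis unfolding eq using 3 Rt by (simp add: \<eta>_def R_def)
      qed
    qed
    finally show "integral {0..x} \<kappa> = \<eta> x - \<eta> 0" using \<eta>0 by simp
  qed
  have gr: "(\<lambda>x. g x * r x) absolutely_integrable_on {s..t}"
  proof -
    have "(\<lambda>x. g x * \<kappa> x) absolutely_integrable_on {s..t}"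
      by (rule set_integrable_subset[OF L2_mult_integrable[OF sobolevD(2)[OF u] \<kappa>L2]]) (use st in auto)
    then show ?thesis
      by (rule absolutely_integrable_spike[of _ _ "{}"]) (auto simp: \<kappa>_def)
  qed
  have wR: "(\<lambda>x. w x * R x) absolutely_integrable_on {s..t}"
    by (intro absolutely_integrable_continuous_real continuous_intros cw cR)
  have Wr: "(\<lambda>x. W x * r x) absolutely_integrable_on {s..t}"
    by (rule absolutely_integrable_continuous_mult(1)[OF cW ri])
  have "0 = integral {0<..} (\<lambda>x. e\<^sup>2 * (g x * \<kappa> x) + V x * (u x * \<eta> x))"
    using weak[OF sob x\<eta>L2 \<eta>0] by simp
  also have "\<dots> = integral {0<..} (\<lambda>x. if x \<in> {s..t} then e\<^sup>2 * (g x * r x + w x * R x) else 0)"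
    by (rule integral_cong) (use e in \<open>auto simp: \<kappa>_def \<eta>_def w_def algebra_simps\<close>)
  also have "\<dots> = integral ({0<..} \<inter> {s..t}) (\<lambda>x. e\<^sup>2 * (g x * r x + w x * R x))"
    by (subst Int_commute, rule Henstock_Kurzweil_Integration.integral_restrict_Int)
  also have "{0<..} \<inter> {s..t} = {s..t}" using st by auto
  also have "integral {s..t} (\<lambda>x. e\<^sup>2 * (g x * r x + w x * R x)) = e\<^sup>2 * integral {s..t} (\<lambda>x. g x * r x + w x * R x)"
    by simp
  finally have "integral {s..t} (\<lambda>x. g x * r x + w x * R x) = 0" using e by simp
  then have 1: "integral {s..t} (\<lambda>x. g x * r x) + integral {s..t} (\<lambda>x. w x * R x) = 0"
    using gr wR by (subst (asm) Henstock_Kurzweil_Integration.integral_add) (auto simp: absolutely_integrable_on_def)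
  \<comment> \<open>\<open>R\<close> vanishes at both ends, which moves the potential term onto
    \<open>r\<close>: the weak equation becomes a vanishing integral of \<open>(g - W) * r\<close>.
    Since \<open>r\<close> itself has integral \<open>R t = 0\<close>, subtracting \<open>c\<close>
    turns this into the integral of \<open>r^2\<close>.\<close>
  have "integral {s..t} (\<lambda>x. w x * R x + W x * r x) = W t * R t - W s * R s"
    by (rule antiderivative_mult(2)) (use st wi ri in \<open>auto simp: W_def R_def\<close>)
  then have 2: "integral {s..t} (\<lambda>x. w x * R x) + integral {s..t} (\<lambda>x. W x * r x) = 0"
    using Wr wR Rt Rs by (subst (asm) Henstock_Kurzweil_Integration.integral_add) (auto simp: absolutely_integrable_on_def)
  have I0: "((\<lambda>x. (g x * r x - W x * r x) - c * r x) has_integral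
      ((integral {s..t} (\<lambda>x. g x * r x) - integral {s..t} (\<lambda>x. W x * r x)) - c * integral {s..t} r)) {s..t}"
    using gr Wr ri by (intro has_integral_diff has_integral_mult_right integrable_integral) (auto simp: absolutely_integrable_on_def)
  have rr: "(g x * r x - W x * r x) - c * r x = (r x)\<^sup>2" for x
    unfolding r_def by (simp add: power2_eq_square algebra_simps)
  have "((\<lambda>x. (r x)\<^sup>2) has_integral ((integral {s..t} (\<lambda>x. g x * r x) - integral {s..t} (\<lambda>x. W x * r x)) - c * integral {s..t} r)) {s..t}"
    using I0 by (simp only: rr)
  moreover have "(integral {s..t} (\<lambda>x. g x * r x) - integral {s..t} (\<lambda>x. W x * r x)) - c * integral {s..t} r = 0"
    using 1 2 Rt by (simp add: R_def)
  ultimately have r2: "((\<lambda>x. (r x)\<^sup>2) has_integral 0) {s..t}" by simp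
  \<comment> \<open>By Cauchy-Schwarz \<open>R\<close> vanishes at every point, so \<open>u\<close>
    is, up to a constant, exactly a primitive of the continuous function
    \<open>W + c\<close>.\<close>
  have R0: "R x = 0" if "x \<in> {s..t}" for x
  proof -
    have sub: "{s..x} \<subseteq> {s..t}" using that by auto
    have i2: "(\<lambda>x. (r x)\<^sup>2) integrable_on {s..x}"
      using integrable_subinterval_real[OF has_integral_integrable[OF r2] sub] .
    have i1: "r integrable_on {s..x}"
      using integrable_subinterval_real[OF _ sub] ri by (auto simp: absolutely_integrable_on_def)
    have "integral {s..x} (\<lambda>x. (r x)\<^sup>2) \<le> integral {s..t} (\<lambda>x. (r x)\<^sup>2)"
      by (rule integral_subset_le[OF sub i2 has_integral_integrable[OF r2]]) simp
    also have "\<dots> = 0" using r2 by (rule integral_unique)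
    finally have "integral {s..x} (\<lambda>x. (r x)\<^sup>2) \<le> 0" .
    moreover have "(R x)\<^sup>2 \<le> (x - s) * integral {s..x} (\<lambda>x. (r x)\<^sup>2)"
      unfolding R_def by (rule integral_squared_le[OF i1 i2]) (use that in auto)
    moreover have "0 \<le> x - s" using that by simp
    ultimately have "(R x)\<^sup>2 \<le> 0" by (meson mult_nonneg_nonpos order_trans)
    then show ?thesis by simp
  qed
  have uW: "integral {s..x} (\<lambda>x. W x + c) = u x - u s" if "x \<in> {s..t}" for x
  proof -
    have sub: "{s..x} \<subseteq> {s..t}" using that by auto
    have "R x = integral {s..x} g - integral {s..x} (\<lambda>x. W x + c)"
      unfolding R_def r_def
      using absolutely_integrable_on_subinterval[OF gi sub] absolutely_integrable_on_subinterval[OF Wci sub]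
      by (intro Henstock_Kurzweil_Integration.integral_diff) (auto simp: absolutely_integrable_on_def)
    moreover have "integral {s..x} g = u x - u s" by (rule sobolev_increment[OF u]) (use that st in auto)
    ultimately show ?thesis using R0[OF that] by simp
  qed
  show ?thesis
  proof (intro exI[of _ "\<lambda>x. W x + c"] ballI conjI)
    fix x assume x: "x \<in> {s<..<t}"
    have "((\<lambda>x. u s + integral {s..x} (\<lambda>x. W x + c)) has_real_derivative 0 + (W x + c)) (at x)"
      by (intro DERIV_add DERIV_const has_real_derivative_indefinite_integral[of s t] continuous_intros cW x)
    then have "((\<lambda>x. u s + integral {s..x} (\<lambda>x. W x + c)) has_real_derivative (W x + c)) (at x)" by simp
    then show "(u has_real_derivative W x + c) (at x)"
      by (rule has_field_derivative_transform_within_open[of _ _ _ "{s<..<t}"]) (use x uW in auto)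
    have "((\<lambda>x. W x + c) has_real_derivative w x + 0) (at x)"
      unfolding W_def by (intro DERIV_add DERIV_const has_real_derivative_indefinite_integral[OF cw x])
    then show "((\<lambda>x. W x + c) has_real_derivative V x * u x / e\<^sup>2) (at x)"
      by (simp add: w_def)
  qed
qed

text \<open>The local derivatives on the neighbourhoods \<open>{x/2<..<2*x}\<close> all coincide
  with \<open>deriv u\<close>, so they fit together on the open half-line.\<close>

lemma weak_solution_regularity:
  assumes e: "e > (0::real)" and u: "sobolev u g" and V: "continuous_on {0..} V"
    and weak: "\<And>\<eta> \<kappa>. sobolev \<eta> \<kappa> \<Longrightarrow> (\<lambda>x. \<bar>x\<bar> * \<eta> x) \<in> L2_halfline \<Longrightarrow> \<eta> 0 = 0 \<Longrightarrow>
        integral {0<..} (\<lambda>x. e\<^sup>2 * (g x * \<kappa> x) + V x * (u x * \<eta> x)) = 0"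
    and x: "x > 0"
  shows "(u has_real_derivative deriv u x) (at x)"
    and "(deriv u has_real_derivative V x * u x / e\<^sup>2) (at x)"
proof -
  have x2: "0 < x/2" "x/2 < 2*x" using x by auto
  obtain u1 where u1: "\<And>y. y \<in> {x/2<..<2*x} \<Longrightarrow> (u has_real_derivative u1 y) (at y)"
    "\<And>y. y \<in> {x/2<..<2*x} \<Longrightarrow> (u1 has_real_derivative V y * u y / e\<^sup>2) (at y)"
    using weak_solution_local_regularity[OF e u V weak x2] by blast
  have d: "u1 y = deriv u y" if "y \<in> {x/2<..<2*x}" for y
    using DERIV_imp_deriv[OF u1(1)[OF that]] by simp
  have xin: "x \<in> {x/2<..<2*x}" using x by auto
  show "(u has_real_derivative deriv u x) (at x)" using u1(1)[OF xin] d[OF xin] by simp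
  show "(deriv u has_real_derivative V x * u x / e\<^sup>2) (at x)"
    by (rule has_field_derivative_transform_within_open[OF u1(2)[OF xin] open_greaterThanLessThan xin d])
qed

text \<open>Connects the square-integrable weak derivative with the classical one, so that
  integrability at infinity passes to expressions in the latter. The start \<open>a > 0\<close>
  stays clear of the origin, where no classical derivative is assumed.\<close>

lemma sobolev_deriv_AE:
  assumes u: "sobolev u g" and d: "\<And>x. x > 0 \<Longrightarrow> (u has_real_derivative u1 x) (at x)"
    and c: "continuous_on {0<..} u1" and a: "0 < a"
  shows "AE x in lebesgue. x \<in> {a..} \<longrightarrow> g x = u1 x"
proof -
  have i: "g absolutely_integrable_on {a..x}" for x
    using L2_local_integrable[OF sobolevD(2)[OF u]] a by simp
  have j: "u1 absolutely_integrable_on {a..x}" for x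
    by (intro absolutely_integrable_continuous_real continuous_on_subset[OF c]) (use a in auto)
  have "AE x in lebesgue. x \<in> {a..} \<longrightarrow> g x - u1 x = 0"
  proof (rule AE_eq_0_if_integrals_zero_ray)
    show "(\<lambda>x. g x - u1 x) absolutely_integrable_on {a..x}" for x
      using i j by (intro set_integral_diff(1))
    fix x assume x: "x \<ge> a"
    have "integral {a..x} u1 = u x - u a"
      by (rule integral_continuous_derivative) (use d a x in auto)
    moreover have "integral {a..x} g = u x - u a"
      by (rule sobolev_increment[OF u]) (use a x in auto)
    ultimately show "integral {a..x} (\<lambda>x. g x - u1 x) = 0"
      using i[of x] j[of x]
      by (subst Henstock_Kurzweil_Integration.integral_diff) (auto simp: absolutely_integrable_on_def)
  qed
  then show ?thesis by eventually_elim auto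
qed


section \<open>Nonnegativity of the quadratic form of a positive solution\<close>

text \<open>A substitute for decay at infinity, which integrability does not imply: a lower bound
  \<open>c\<close> from some point on would make the integral infinite.\<close>

lemma integrable_halfline_small_values:
  fixes f :: "real \<Rightarrow> real"
  assumes f: "f absolutely_integrable_on {0<..}" and c: "c > 0"
  shows "\<exists>x>0. x \<ge> T \<and> f x < c"
proof (rule ccontr)
  assume "\<not> ?thesis"
  then have ge: "f x \<ge> c" if "x \<ge> max T 1" for x using that by force
  define A where "A = max T 1"
  define B where "B = integral {0<..} (\<lambda>x. \<bar>f x\<bar>)"
  have fi: "(\<lambda>x. \<bar>f x\<bar>) integrable_on {0<..}" using f by (simp add: absolutely_integrable_on_def)
  have "c * real n \<le> B" for n
  proof -
    have sub: "{A..A + real n} \<subseteq> {0<..}" unfolding A_def by auto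
    have i: "(\<lambda>x. \<bar>f x\<bar>) integrable_on {A..A + real n}"
      using integrable_on_subinterval[OF fi sub] .
    have "c * real n = integral {A..A + real n} (\<lambda>x. c)" by simp
    also have "\<dots> \<le> integral {A..A + real n} (\<lambda>x. \<bar>f x\<bar>)"
      by (rule integral_le[OF _ i]) (use ge in \<open>force simp: A_def\<close>)+
    also have "\<dots> \<le> B"
      unfolding B_def by (rule integral_subset_le[OF sub i fi]) simp
    finally show ?thesis .
  qed
  moreover obtain n where "B / c < real n" using reals_Archimedean2 by blast
  ultimately show False using c by (metis linorder_not_less mult.commute pos_divide_less_eq)
qed

lemma integral_tendsto_halfline:
  fixes q :: "real \<Rightarrow> real"
  assumes "q absolutely_integrable_on {0<..}"
  shows "((\<lambda>t. integral {0..t} q) \<longlongrightarrow> integral {0<..} q) at_top" "q absolutely_integrable_on {0..}"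
proof -
  show q0: "q absolutely_integrable_on {0..}"
    by (rule absolutely_integrable_spike_set[OF assms]) (auto intro: negligible_subset[of "{0}"])
  have "((\<lambda>t. LINT x:{0..t}|lebesgue. q x) \<longlongrightarrow> (LINT x:{0..}|lebesgue. q x)) at_top"
    by (rule tendsto_set_lebesgue_integral_at_top[OF _ q0]) simp
  moreover have "(LINT x:{0..t}|lebesgue. q x) = integral {0..t} q" for t
    by (rule set_lebesgue_integral_eq_integral(2)) (rule set_integrable_subset[OF q0]; auto)
  moreover have "(LINT x:{0..}|lebesgue. q x) = integral {0..} q"
    by (rule set_lebesgue_integral_eq_integral(2)[OF q0])
  moreover have "integral {0..} q = integral {0<..} q"
    by (rule integral_spike_set) (auto intro: negligible_subset[of "{0}"])
  ultimately show "((\<lambda>t. integral {0..t} q) \<longlongrightarrow> integral {0<..} q) at_top" by simp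
qed

text \<open>Picone-type argument on an interval away from \<open>0\<close>, where
  \<open>u1 / u\<close> is continuous, with its boundary terms retained. Allowing any
  \<open>\<eta>\<close> lets it be applied to straight lines as well as to the perturbation.\<close>

lemma riccati_inequality:
  fixes e :: real
  assumes e: "e > 0" and V: "continuous_on {0..} V"
    and u: "\<And>x. x > 0 \<Longrightarrow> (u has_real_derivative u1 x) (at x)"
    and u1: "\<And>x. x > 0 \<Longrightarrow> (u1 has_real_derivative V x * u x / e\<^sup>2) (at x)"
    and pos: "\<And>x. x > 0 \<Longrightarrow> u x > 0"
    and st: "0 < s" "s \<le> t"
    and \<kappa>: "\<kappa> absolutely_integrable_on {s..t}" "(\<lambda>x. (\<kappa> x)\<^sup>2) integrable_on {s..t}"
    and \<eta>: "\<And>x. x \<in> {s..t} \<Longrightarrow> integral {s..x} \<kappa> = \<eta> x - \<eta> s"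
  shows "e\<^sup>2 * (u1 t / u t * (\<eta> t)\<^sup>2) - e\<^sup>2 * (u1 s / u s * (\<eta> s)\<^sup>2)
     \<le> integral {s..t} (\<lambda>x. e\<^sup>2 * (\<kappa> x)\<^sup>2 + V x * (\<eta> x)\<^sup>2)"
proof -
  define p where "p x = u1 x / u x" for x
  \<comment> \<open>The right-hand side of the Riccati equation that follows from
    \<open>u'' = V u / e^2\<close>.\<close>
  define p' where "p' x = V x / e\<^sup>2 - (p x)\<^sup>2" for x
  have dp: "(p has_real_derivative p' x) (at x)" if "x > 0" for x
  proof -
    have "(p has_real_derivative (V x * u x / e\<^sup>2 * u x - u1 x * u1 x) / (u x * u x)) (at x)"
      unfolding p_def[abs_def] using pos[OF that] by (intro DERIV_divide u u1 that) auto
    moreover have "(V x * u x / e\<^sup>2 * u x - u1 x * u1 x) / (u x * u x) = p' x"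
      unfolding p'_def p_def using pos[OF that] e by (simp add: divide_simps power2_eq_square)
    ultimately show ?thesis by simp
  qed
  have cp: "continuous_on {s..t} p"
    using st by (intro continuous_at_imp_continuous_on ballI DERIV_isCont[OF dp]) auto
  have cV: "continuous_on {s..t} V" by (rule continuous_on_subset[OF V]) (use st in auto)
  have cp': "continuous_on {s..t} p'" unfolding p'_def using e by (intro continuous_intros cp cV) auto
  have c\<eta>: "continuous_on {s..t} \<eta>" by (rule continuous_on_antiderivative[OF \<kappa>(1) \<eta>])
  have p'i: "p' absolutely_integrable_on {s..t}" using cp' by (rule absolutely_integrable_continuous_real)
  have sq: "(\<lambda>x. \<kappa> x * \<eta> x + \<eta> x * \<kappa> x) absolutely_integrable_on {s..t}"
    by (rule antiderivative_mult(1)[OF st(2) \<kappa>(1) \<kappa>(1) \<eta> \<eta>])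
  have sqi: "integral {s..x} (\<lambda>x. \<kappa> x * \<eta> x + \<eta> x * \<kappa> x) = (\<eta> x)\<^sup>2 - (\<eta> s)\<^sup>2" if "x \<in> {s..t}" for x
  proof -
    have k: "\<kappa> absolutely_integrable_on {s..x}"
      by (rule absolutely_integrable_on_subinterval[OF \<kappa>(1)]) (use that in auto)
    have "integral {s..y} \<kappa> = \<eta> y - \<eta> s" if "y \<in> {s..x}" for y
      using \<eta>[of y] that \<open>x \<in> {s..t}\<close> by simp
    from antiderivative_mult(2)[OF _ k k this this] show ?thesis
      using that by (simp add: power2_eq_square)
  qed
  have pint: "integral {s..x} p' = p x - p s" if "x \<in> {s..t}" for x
    by (rule integral_continuous_derivative) (use dp st that in auto)
  \<comment> \<open>\<open>Z\<close> is the derivative of \<open>p * \<eta>^2\<close>, reached by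
    two uses of the product rule because \<open>\<eta>\<close> has only an integrable
    derivative.\<close>
  define Z where "Z x = p' x * (\<eta> x)\<^sup>2 + p x * (\<kappa> x * \<eta> x + \<eta> x * \<kappa> x)" for x
  have Zi: "Z absolutely_integrable_on {s..t}" and Zint: "integral {s..t} Z = p t * (\<eta> t)\<^sup>2 - p s * (\<eta> s)\<^sup>2"
    unfolding Z_def[abs_def]
    by (rule antiderivative_mult[OF st(2) p'i sq pint sqi]; assumption)+
  have "integral {s..t} (\<lambda>x. e\<^sup>2 * Z x) \<le> integral {s..t} (\<lambda>x. e\<^sup>2 * (\<kappa> x)\<^sup>2 + V x * (\<eta> x)\<^sup>2)"
  proof (rule integral_le)
    show "(\<lambda>x. e\<^sup>2 * Z x) integrable_on {s..t}"
      using Zi by (intro integrable_on_mult_right) (simp add: absolutely_integrable_on_def)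
    show "(\<lambda>x. e\<^sup>2 * (\<kappa> x)\<^sup>2 + V x * (\<eta> x)\<^sup>2) integrable_on {s..t}"
      by (intro integrable_add integrable_on_mult_right \<kappa> integrable_continuous_real continuous_intros cV c\<eta>)
    fix x
    \<comment> \<open>The Riccati equation cancels \<open>V\<close> and leaves a perfect
      square.\<close>
    have "e\<^sup>2 * (\<kappa> x)\<^sup>2 + V x * (\<eta> x)\<^sup>2 - e\<^sup>2 * Z x = e\<^sup>2 * (\<kappa> x - p x * \<eta> x)\<^sup>2"
      unfolding Z_def p'_def using e by (simp add: field_simps power2_eq_square)
    then show "e\<^sup>2 * Z x \<le> e\<^sup>2 * (\<kappa> x)\<^sup>2 + V x * (\<eta> x)\<^sup>2"
      by (metis diff_ge_0_iff_ge mult_nonneg_nonneg zero_le_power2)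
  qed
  also have "integral {s..t} (\<lambda>x. e\<^sup>2 * Z x) = e\<^sup>2 * (p t * (\<eta> t)\<^sup>2 - p s * (\<eta> s)\<^sup>2)"
    using Zint by simp
  finally show ?thesis unfolding p_def by (simp add: right_diff_distrib)
qed

text \<open>Cost of a straight line with slope \<open>m\<close> and values bounded by
  \<open>h\<close>; on \<open>{a..b}\<close> the potential is at most
  \<open>b^2 + M\<close>.\<close>

lemma integral_linear_le:
  fixes e :: real
  assumes V: "continuous_on {0..} V" "\<And>x. x \<ge> 0 \<Longrightarrow> \<bar>V x\<bar> \<le> x\<^sup>2 + M"
    and ab: "0 < a" "a \<le> b" and l: "\<And>x. x \<in> {a..b} \<Longrightarrow> \<bar>c + m * x\<bar> \<le> h"
  shows "integral {a..b} (\<lambda>x. e\<^sup>2 * m\<^sup>2 + V x * (c + m * x)\<^sup>2) \<le> (b - a) * (e\<^sup>2 * m\<^sup>2 + (b\<^sup>2 + M) * h\<^sup>2)"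
proof -
  have cV: "continuous_on {a..b} V" by (rule continuous_on_subset[OF V(1)]) (use ab in auto)
  have "integral {a..b} (\<lambda>x. e\<^sup>2 * m\<^sup>2 + V x * (c + m * x)\<^sup>2) \<le> integral {a..b} (\<lambda>x. e\<^sup>2 * m\<^sup>2 + (b\<^sup>2 + M) * h\<^sup>2)"
  proof (rule integral_le)
    show "(\<lambda>x. e\<^sup>2 * m\<^sup>2 + V x * (c + m * x)\<^sup>2) integrable_on {a..b}"
      by (intro integrable_continuous_real continuous_intros cV)
    fix x assume x: "x \<in> {a..b}"
    have "x\<^sup>2 \<le> b\<^sup>2" using x ab by (intro power_mono) auto
    moreover have "\<bar>V x\<bar> \<le> x\<^sup>2 + M" using V(2)[of x] x ab by simp
    ultimately have v: "V x \<le> b\<^sup>2 + M" "0 \<le> b\<^sup>2 + M" by linarith+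
    have "(c + m * x)\<^sup>2 \<le> h\<^sup>2" using l[OF x] by (metis abs_ge_zero power2_abs power_mono)
    then have "V x * (c + m * x)\<^sup>2 \<le> (b\<^sup>2 + M) * h\<^sup>2" using v by (intro mult_mono) auto
    then show "e\<^sup>2 * m\<^sup>2 + V x * (c + m * x)\<^sup>2 \<le> e\<^sup>2 * m\<^sup>2 + (b\<^sup>2 + M) * h\<^sup>2" by simp
  qed auto
  then show ?thesis using ab by simp
qed

text \<open>The weight |x| on both factors absorbs the quadratic growth of \<open>V\<close>.\<close>

lemma L2_potential_integrable:
  assumes V: "continuous_on {0..} V" "\<And>x. x \<ge> 0 \<Longrightarrow> \<bar>V x\<bar> \<le> x\<^sup>2 + M"
    and f: "f \<in> L2_halfline" "(\<lambda>x. \<bar>x\<bar> * f x) \<in> L2_halfline"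
    and g: "g \<in> L2_halfline" "(\<lambda>x. \<bar>x\<bar> * g x) \<in> L2_halfline"
  shows "(\<lambda>x. V x * (f x * g x)) absolutely_integrable_on {0<..}"
proof (rule measurable_bounded_by_integrable_imp_absolutely_integrable)
  have "V \<in> borel_measurable (lebesgue_on {0<..})"
    by (rule continuous_imp_measurable_on_sets_lebesgue) (auto intro: continuous_on_subset[OF V(1)])
  then show "(\<lambda>x. V x * (f x * g x)) \<in> borel_measurable (lebesgue_on {0<..})"
    using f(1) g(1) by (auto simp: L2_halfline_iff)
  show "(\<lambda>x. \<bar>(\<bar>x\<bar> * f x) * (\<bar>x\<bar> * g x)\<bar> + M * \<bar>f x * g x\<bar>) integrable_on {0<..}"
    using L2_mult_integrable[OF f(2) g(2)] L2_mult_integrable[OF f(1) g(1)]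
    by (intro integrable_add integrable_on_mult_right) (simp_all add: absolutely_integrable_on_def)
  show "norm (V x * (f x * g x)) \<le> \<bar>(\<bar>x\<bar> * f x) * (\<bar>x\<bar> * g x)\<bar> + M * \<bar>f x * g x\<bar>" if "x \<in> {0<..}" for x
  proof -
    have "norm (V x * (f x * g x)) \<le> (x\<^sup>2 + M) * \<bar>f x * g x\<bar>"
      using V(2)[of x] that by (auto simp: abs_mult intro!: mult_right_mono)
    also have "\<dots> = \<bar>(\<bar>x\<bar> * f x) * (\<bar>x\<bar> * g x)\<bar> + M * \<bar>f x * g x\<bar>"
      by (simp add: abs_mult power2_eq_square algebra_simps)
    finally show ?thesis .
  qed
qed simp

text \<open>
  The boundary terms \<open>u1 / u * \<eta>\<^sup>2\<close> of the Riccati inequality on \<open>[s,t]\<close> are themselves controlled by the Riccati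
  inequality, applied to the linear function running from \<open>0\<close> at \<open>s/2\<close> to \<open>\<eta> s\<close> at \<open>s\<close>, and to the one
  running from \<open>\<eta> t\<close> at \<open>t\<close> to \<open>0\<close> at \<open>t+1\<close>.
\<close>

lemma positive_solution_quadratic_form_nonneg:
  fixes e :: real
  assumes e: "e > 0" and V: "continuous_on {0..} V" "\<And>x. x \<ge> 0 \<Longrightarrow> \<bar>V x\<bar> \<le> x\<^sup>2 + M"
    and u: "\<And>x. x > 0 \<Longrightarrow> (u has_real_derivative u1 x) (at x)"
    and u1: "\<And>x. x > 0 \<Longrightarrow> (u1 has_real_derivative V x * u x / e\<^sup>2) (at x)"
    and pos: "\<And>x. x > 0 \<Longrightarrow> u x > 0"
    and \<eta>: "sobolev \<eta> \<kappa>" "(\<lambda>x. \<bar>x\<bar> * \<eta> x) \<in> L2_halfline" "\<eta> 0 = 0"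
  shows "0 \<le> integral {0<..} (\<lambda>x. e\<^sup>2 * (\<kappa> x)\<^sup>2 + V x * (\<eta> x)\<^sup>2)"
proof (rule ccontr)
  define q where "q x = e\<^sup>2 * (\<kappa> x)\<^sup>2 + V x * (\<eta> x)\<^sup>2" for x
  define P where "P x = e\<^sup>2 * (u1 x / u x * (\<eta> x)\<^sup>2)" for x
  \<comment> \<open>Cost bound for the line from \<open>\<eta> t\<close> to \<open>0\<close> over
    \<open>{t..t+1}\<close>: slope \<open>- \<eta> t\<close>, potential at most
    \<open>(t+1)^2 + M\<close>. It bounds \<open>- P t\<close>.\<close>
  define D where "D t = (\<eta> t)\<^sup>2 * (e\<^sup>2 + ((t+1)\<^sup>2 + M))" for t
  define J where "J s = integral {0..s} (\<lambda>x. (\<kappa> x)\<^sup>2)" for s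
  \<comment> \<open>The line on \<open>{s/2..s}\<close> has slope \<open>2 * \<eta> s / s\<close>,
    so its kinetic cost is \<open>2 * e^2 * (\<eta> s)^2 / s\<close>, at most
    \<open>2 * e^2 * J s\<close> by Cauchy-Schwarz and \<open>\<eta> 0 = 0\<close>. For
    \<open>s \<le> 1\<close> the potential adds at most \<open>(1 + M) * J s\<close>.\<close>
  define C where "C = 2 * e\<^sup>2 + (1 + M)"
  have M: "M \<ge> 0" using V(2)[of 0] by simp
  have \<kappa>2: "(\<lambda>x. (\<kappa> x)\<^sup>2) absolutely_integrable_on {a..b}" if "0 \<le> a" for a b
    using L2_square_integrable_Icc[OF sobolevD(2)[OF \<eta>(1)] that] .
  have \<kappa>i: "\<kappa> absolutely_integrable_on {a..b}" if "0 \<le> a" for a b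
    using L2_local_integrable[OF sobolevD(2)[OF \<eta>(1)] that] .
  have V\<eta>: "(\<lambda>x. V x * (\<eta> x * \<eta> x)) absolutely_integrable_on {0<..}"
    using sobolevD(1)[OF \<eta>(1)] \<eta>(2) by (intro L2_potential_integrable[OF V]) 
  have qi: "q absolutely_integrable_on {0<..}"
    unfolding q_def[abs_def] using V\<eta> sobolevD(2)[OF \<eta>(1)]
    by (intro set_integral_add(1) set_integrable_mult_right) (auto simp: L2_halfline_iff power2_eq_square)
  have qi0: "q absolutely_integrable_on {0..b}" for b
    by (rule set_integrable_subset[OF integral_tendsto_halfline(2)[OF qi]]) auto
  have lower: "- P t \<le> D t" if t: "t > 0" for t
  proof -
    have "e\<^sup>2 * (u1 (t+1) / u (t+1) * (\<eta> t * (t + 1) + (- \<eta> t) * (t+1))\<^sup>2) - e\<^sup>2 * (u1 t / u t * (\<eta> t * (t + 1) + (- \<eta> t) * t)\<^sup>2)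
      \<le> integral {t..t+1} (\<lambda>x. e\<^sup>2 * (- \<eta> t)\<^sup>2 + V x * (\<eta> t * (t + 1) + (- \<eta> t) * x)\<^sup>2)"
      by (rule riccati_inequality[OF e V(1) u u1 pos, where \<kappa> = "\<lambda>x. - \<eta> t" and \<eta> = "\<lambda>x. \<eta> t * (t + 1) + (- \<eta> t) * x"])
         (use t in \<open>auto simp: algebra_simps intro!: absolutely_integrable_continuous_real\<close>)
    also have "\<dots> \<le> (t + 1 - t) * (e\<^sup>2 * (- \<eta> t)\<^sup>2 + ((t+1)\<^sup>2 + M) * (\<bar>\<eta> t\<bar>)\<^sup>2)"
    proof (rule integral_linear_le[OF V])
      fix x assume x: "x \<in> {t..t+1}"
      have "\<bar>\<eta> t * (t + 1) + (- \<eta> t) * x\<bar> = \<bar>\<eta> t\<bar> * \<bar>t + 1 - x\<bar>"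
        by (simp add: abs_mult[symmetric] algebra_simps)
      also have "\<dots> \<le> \<bar>\<eta> t\<bar> * 1" using x by (intro mult_left_mono) auto
      finally show "\<bar>\<eta> t * (t + 1) + (- \<eta> t) * x\<bar> \<le> \<bar>\<eta> t\<bar>" by simp
    qed (use t in auto)
    finally show ?thesis unfolding P_def D_def by (simp add: algebra_simps)
  qed
  have upper: "P s \<le> C * J s" if s: "0 < s" "s \<le> 1" for s
  proof -
    have sq: "(\<eta> s)\<^sup>2 \<le> s * J s"
    proof -
      have "(integral {0..s} \<kappa>)\<^sup>2 \<le> (s - 0) * integral {0..s} (\<lambda>x. (\<kappa> x)\<^sup>2)"
        using \<kappa>i[of 0 s] \<kappa>2[of 0 s] s by (intro integral_squared_le) (auto simp: absolutely_integrable_on_def)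
      then show ?thesis using sobolevD(3)[OF \<eta>(1), of s] \<eta>(3) s by (simp add: J_def)
    qed
    define m where "m = 2 * \<eta> s / s"
    have ms: "- \<eta> s + m * s = \<eta> s" "- \<eta> s + m * (s/2) = 0" unfolding m_def using s by auto
    have "e\<^sup>2 * (u1 s / u s * (- \<eta> s + m * s)\<^sup>2) - e\<^sup>2 * (u1 (s/2) / u (s/2) * (- \<eta> s + m * (s/2))\<^sup>2)
      \<le> integral {s/2..s} (\<lambda>x. e\<^sup>2 * m\<^sup>2 + V x * (- \<eta> s + m * x)\<^sup>2)"
      by (rule riccati_inequality[OF e V(1) u u1 pos, where \<kappa> = "\<lambda>x. m" and \<eta> = "\<lambda>x. - \<eta> s + m * x"])
         (use s in \<open>auto simp: algebra_simps intro!: absolutely_integrable_continuous_real\<close>)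
    also have "\<dots> \<le> (s - s/2) * (e\<^sup>2 * m\<^sup>2 + (s\<^sup>2 + M) * (\<bar>\<eta> s\<bar>)\<^sup>2)"
    proof (rule integral_linear_le[OF V])
      fix x assume x: "x \<in> {s/2..s}"
      have "- \<eta> s + m * x = \<eta> s * (2 * x / s - 1)" unfolding m_def by (simp add: algebra_simps)
      then have "\<bar>- \<eta> s + m * x\<bar> = \<bar>\<eta> s\<bar> * \<bar>2 * x / s - 1\<bar>" by (simp add: abs_mult)
      also have "\<dots> \<le> \<bar>\<eta> s\<bar> * 1" using x s by (intro mult_left_mono) (auto simp: abs_le_iff field_simps)
      finally show "\<bar>- \<eta> s + m * x\<bar> \<le> \<bar>\<eta> s\<bar>" by simp
    qed (use s in auto)
    finally have "P s \<le> (s - s/2) * (e\<^sup>2 * m\<^sup>2 + (s\<^sup>2 + M) * (\<eta> s)\<^sup>2)"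
      unfolding ms P_def by simp
    also have "\<dots> = (2 * e\<^sup>2 + s\<^sup>2 / 2 * (s\<^sup>2 + M)) * ((\<eta> s)\<^sup>2 / s)"
      unfolding m_def using s by (simp add: field_simps power2_eq_square)
    also have "\<dots> \<le> C * J s"
    proof (rule mult_mono)
      have "s\<^sup>2 \<le> 1" using s by (simp add: power_le_one)
      then have "s\<^sup>2 / 2 * (s\<^sup>2 + M) \<le> 1 * (1 + M)" using M by (intro mult_mono) auto
      then show "2 * e\<^sup>2 + s\<^sup>2 / 2 * (s\<^sup>2 + M) \<le> C" unfolding C_def by simp
      show "(\<eta> s)\<^sup>2 / s \<le> J s" using sq s by (simp add: field_simps)
      show "0 \<le> C" unfolding C_def using M by simp
    qed (use s in auto)
    finally show ?thesis .
  qed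
  \<comment> \<open>As \<open>s\<close> tends to \<open>0\<close>, \<open>J s\<close> tends to
    \<open>0\<close> by continuity, so the possibly singular boundary term near the origin leaves no
    trace.\<close>
  have main: "0 \<le> integral {0..t} q + D t" if t: "t \<ge> 1" for t
  proof -
    define A where "A s = integral {0..t} q - integral {0..s} q + C * J s + D t" for s
    have cA: "continuous_on {0..1} A"
      unfolding A_def J_def using qi0[of 1] \<kappa>2[of 0 1]
      by (intro continuous_intros indefinite_integral_continuous_1) (auto simp: absolutely_integrable_on_def)
    have A: "0 \<le> A s" if s: "s \<in> {0<..<1}" for s
    proof -
      have "P t - P s \<le> integral {s..t} q"
        unfolding P_def q_def[abs_def]
        by (rule riccati_inequality[OF e V(1) u u1 pos])
           (use s t \<kappa>i[of s t] \<kappa>2[of s t] sobolev_increment[OF \<eta>(1)] in \<open>auto simp: absolutely_integrable_on_def\<close>)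
      moreover have "integral {0..s} q + integral {s..t} q = integral {0..t} q"
        using s t qi0[of t] by (intro Henstock_Kurzweil_Integration.integral_combine) (auto simp: absolutely_integrable_on_def)
      ultimately show ?thesis using lower[of t] upper[of s] s t unfolding A_def by simp
    qed
    have "0 \<le> A 0"
      by (rule continuous_ge_on_closure[of "{0<..<1}" A 0 0]) (use cA A in auto)
    then show ?thesis unfolding A_def J_def by simp
  qed
  assume "\<not> 0 \<le> integral {0<..} (\<lambda>x. e\<^sup>2 * (\<kappa> x)\<^sup>2 + V x * (\<eta> x)\<^sup>2)"
  then have neg: "integral {0<..} q < 0" unfolding q_def[abs_def] by simp
  \<comment> \<open>A negative limit \<open>I\<close> forces
    \<open>integral {0..t} q < I / 2\<close> for all large \<open>t\<close>, while integrability of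
    \<open>D\<close> offers such a \<open>t\<close> with \<open>D t < - I / 2\<close>; together they
    contradict \<open>main\<close>.\<close>
  define I where "I = integral {0<..} q"
  have "I < I / 2" using neg unfolding I_def by simp
  then have "\<forall>\<^sub>F t in at_top. integral {0..t} q < I / 2"
    using integral_tendsto_halfline(1)[OF qi] unfolding I_def by (rule order_tendstoD(2)[rotated])
  then obtain T where T: "\<And>t. t \<ge> T \<Longrightarrow> integral {0..t} q < I / 2"
    unfolding eventually_at_top_linorder by blast
  have Di: "D absolutely_integrable_on {0<..}"
  proof -
    \<comment> \<open>\<open>(x+1)^2\<close> outgrows \<open>x^2\<close> plus a constant; after
      scaling by \<open>1/3\<close> the growth condition holds, by
      \<open>2 * x \<le> x^2 + 1\<close>.\<close>
    define V2 where "V2 x = 1/3 * (e\<^sup>2 + ((x+1)\<^sup>2 + M))" for x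
    have "(\<lambda>x. V2 x * (\<eta> x * \<eta> x)) absolutely_integrable_on {0<..}"
    proof (rule L2_potential_integrable[where M = "1 + e\<^sup>2 + M"])
      show "continuous_on {0..} V2" unfolding V2_def by (intro continuous_intros)
      show "\<bar>V2 x\<bar> \<le> x\<^sup>2 + (1 + e\<^sup>2 + M)" if "x \<ge> 0" for x
      proof -
        have "0 \<le> (x - 1)\<^sup>2" by simp
        then have x2: "2 * x \<le> x\<^sup>2 + 1" by (simp add: power2_diff)
        have V2: "V2 x = (e\<^sup>2 + x\<^sup>2 + 2 * x + 1 + M) / 3" unfolding V2_def by (simp add: power2_sum)
        have sq: "0 \<le> e\<^sup>2" "0 \<le> x\<^sup>2" by simp_all
        have "0 \<le> V2 x" unfolding V2 using that M sq by simp
        moreover have "V2 x \<le> x\<^sup>2 + (1 + e\<^sup>2 + M)" unfolding V2 using x2 M sq by argo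
        ultimately show ?thesis by simp
      qed
    qed (use sobolevD(1)[OF \<eta>(1)] \<eta>(2) in auto)
    then have "(\<lambda>x. 3 * (V2 x * (\<eta> x * \<eta> x))) absolutely_integrable_on {0<..}"
      by (rule set_integrable_mult_right)
    moreover have "3 * (V2 x * (\<eta> x * \<eta> x)) = D x" for x
      unfolding V2_def D_def by (simp add: power2_eq_square)
    ultimately show ?thesis by simp
  qed
  have "- I / 2 > 0" using neg unfolding I_def by simp
  then obtain t where t: "t \<ge> max T 1" "D t < - I / 2"
    using integrable_halfline_small_values[OF Di, of "- I / 2" "max T 1"] by blast
  then show False using T[of t] main[of t] by simp
qed


section \<open>Expansion of the energy\<close>

definition weighted_sobolev :: "(real \<Rightarrow> real) \<Rightarrow> (real \<Rightarrow> real) \<Rightarrow> bool" where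
  "weighted_sobolev f g \<longleftrightarrow> sobolev f g \<and> (\<lambda>x. \<bar>x\<bar> * f x) \<in> L2_halfline"

lemma weighted_sobolevD:
  assumes "weighted_sobolev f g"
  shows "sobolev f g" "(\<lambda>x. \<bar>x\<bar> * f x) \<in> L2_halfline" "f \<in> L2_halfline" "g \<in> L2_halfline" "continuous_on {0..} f"
  using assms sobolevD sobolev_continuous unfolding weighted_sobolev_def by blast+

lemma weighted_sobolev_weak_deriv:
  assumes "f \<in> H1_halfline \<inter> L21_halfline"
  shows "weighted_sobolev f (weak_deriv f)"
  using assms H1_halfline_imp_sobolev unfolding weighted_sobolev_def L21_halfline_def by blast

lemma weighted_sobolev_imp_mem:
  assumes "weighted_sobolev f g"
  shows "f \<in> H1_halfline \<inter> L21_halfline"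
  using weighted_sobolevD[OF assms] sobolev_imp_H1_halfline(1) unfolding L21_halfline_def by blast

lemma weighted_sobolev_add:
  assumes "weighted_sobolev f1 g1" "weighted_sobolev f2 g2"
  shows "weighted_sobolev (\<lambda>x. f1 x + f2 x) (\<lambda>x. g1 x + g2 x)"
  using sobolev_add[of f1 g1 f2 g2] L2_add[of "\<lambda>x. \<bar>x\<bar> * f1 x" "\<lambda>x. \<bar>x\<bar> * f2 x"] assms
  unfolding weighted_sobolev_def by (simp add: distrib_left)

lemma weighted_sobolev_cmult:
  assumes "weighted_sobolev f g"
  shows "weighted_sobolev (\<lambda>x. c * f x) (\<lambda>x. c * g x)"
  using sobolev_cmult[of f g c] L2_cmult[of "\<lambda>x. \<bar>x\<bar> * f x" c] assms
  unfolding weighted_sobolev_def by (simp add: mult.left_commute)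

lemma weighted_sobolev_diff:
  assumes "weighted_sobolev f1 g1" "weighted_sobolev f2 g2"
  shows "weighted_sobolev (\<lambda>x. f1 x - f2 x) (\<lambda>x. g1 x - g2 x)"
  using weighted_sobolev_add[OF assms(1) weighted_sobolev_cmult[OF assms(2), of "-1"]] by simp

lemma admissibleI:
  assumes "weighted_sobolev f1 g1" "weighted_sobolev f2 g2" "f1 0 = \<alpha>" "f2 0 = \<alpha>"
  shows "(f1, f2) \<in> admissible \<alpha>"
  using assms weighted_sobolev_imp_mem unfolding admissible_def by auto

lemma admissibleD:
  assumes "(f1, f2) \<in> admissible \<alpha>"
  shows "weighted_sobolev f1 (weak_deriv f1)" "weighted_sobolev f2 (weak_deriv f2)" "f1 0 = \<alpha>" "f2 0 = \<alpha>"
  using assms weighted_sobolev_weak_deriv unfolding admissible_def by auto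

lemma integral_cong_AE_halfline:
  fixes F G :: "real \<Rightarrow> real"
  assumes "AE x in lebesgue. x > 0 \<longrightarrow> F x = G x"
  shows "integral {0<..} F = integral {0<..} G"
proof -
  obtain N where N: "N \<in> null_sets lebesgue" "{x \<in> space lebesgue. \<not> (x > 0 \<longrightarrow> F x = G x)} \<subseteq> N"
    using assms unfolding eventually_ae_filter by blast
  show ?thesis
    by (rule integral_spike[of N]) (use N in \<open>auto simp: negligible_iff_null_sets\<close>)
qed

lemma quadratic_monomial_integrable:
  assumes "weighted_sobolev f1 g1" "weighted_sobolev f2 g2"
  shows "(\<lambda>x. (x\<^sup>2 - 1) * (f1 x * f2 x)) absolutely_integrable_on {0<..}"
  by (rule L2_potential_integrable[where M = 1])
     (use assms in \<open>auto intro!: continuous_intros simp: weighted_sobolevD abs_le_iff\<close>)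

text \<open>The first two factors are bounded and together play the part of a potential.\<close>

lemma quartic_monomial_integrable:
  assumes "weighted_sobolev f1 g1" "weighted_sobolev f2 g2" "weighted_sobolev f3 g3" "weighted_sobolev f4 g4"
  shows "(\<lambda>x. f1 x * f2 x * (f3 x * f4 x)) absolutely_integrable_on {0<..}"
proof -
  obtain B1 where B1: "B1 \<ge> 0" "\<And>x. x \<ge> 0 \<Longrightarrow> \<bar>f1 x\<bar> \<le> B1"
    using sobolev_bounded[OF weighted_sobolevD(1)[OF assms(1)]] by blast
  obtain B2 where B2: "B2 \<ge> 0" "\<And>x. x \<ge> 0 \<Longrightarrow> \<bar>f2 x\<bar> \<le> B2"
    using sobolev_bounded[OF weighted_sobolevD(1)[OF assms(2)]] by blast
  show ?thesis
  proof (rule L2_potential_integrable[where M = "B1 * B2"])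
    show "continuous_on {0..} (\<lambda>x. f1 x * f2 x)"
      by (intro continuous_intros assms[THEN weighted_sobolevD(5)])
    show "\<bar>f1 x * f2 x\<bar> \<le> x\<^sup>2 + B1 * B2" if "x \<ge> 0" for x
    proof -
      have "\<bar>f1 x * f2 x\<bar> \<le> B1 * B2" unfolding abs_mult using B1 B2 that by (intro mult_mono) auto
      then show ?thesis by (simp add: add_increasing)
    qed
  qed (use assms in \<open>auto simp: weighted_sobolevD\<close>)
qed

section \<open>Energy density and its variations\<close>

text \<open>The derivative values are separate arguments, so that any version of the weak
  derivatives can be inserted and the expansion becomes plain algebra.\<close>

definition gp_density :: "real \<Rightarrow> real \<Rightarrow> real \<Rightarrow> real \<Rightarrow> real \<Rightarrow> real \<Rightarrow> real \<Rightarrow> real" where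
  "gp_density \<epsilon> \<gamma> x p q p' q' = \<epsilon>\<^sup>2 * p'\<^sup>2 + \<epsilon>\<^sup>2 * q'\<^sup>2 + (x\<^sup>2 - 1) * (p\<^sup>2 + q\<^sup>2)
     + 1/2 * (p\<^sup>2 + q\<^sup>2)\<^sup>2 + (\<gamma> - 1) * p\<^sup>2 * q\<^sup>2"

lemma gp_density_integrable:
  assumes p: "weighted_sobolev p p'" and q: "weighted_sobolev q q'"
  shows "(\<lambda>x. gp_density \<epsilon> \<gamma> x (p x) (q x) (p' x) (q' x)) absolutely_integrable_on {0<..}"
proof -
  note L = L2_mult_integrable[OF weighted_sobolevD(4) weighted_sobolevD(4)]
  have "(\<lambda>x. \<epsilon>\<^sup>2 * (p' x * p' x) + \<epsilon>\<^sup>2 * (q' x * q' x) + (x\<^sup>2 - 1) * (p x * p x) + (x\<^sup>2 - 1) * (q x * q x)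
     + 1/2 * (p x * p x * (p x * p x)) + 1/2 * (q x * q x * (q x * q x)) + \<gamma> * (p x * p x * (q x * q x))) absolutely_integrable_on {0<..}"
    by (intro set_integral_add(1) set_integrable_mult_right L[OF p p] L[OF q q]
        quadratic_monomial_integrable[OF p p] quadratic_monomial_integrable[OF q q]
        quartic_monomial_integrable[OF p p p p] quartic_monomial_integrable[OF q q q q] quartic_monomial_integrable[OF p p q q])
  moreover have "(\<lambda>x. \<epsilon>\<^sup>2 * (p' x * p' x) + \<epsilon>\<^sup>2 * (q' x * q' x) + (x\<^sup>2 - 1) * (p x * p x) + (x\<^sup>2 - 1) * (q x * q x)
     + 1/2 * (p x * p x * (p x * p x)) + 1/2 * (q x * q x * (q x * q x)) + \<gamma> * (p x * p x * (q x * q x)))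
     = (\<lambda>x. gp_density \<epsilon> \<gamma> x (p x) (q x) (p' x) (q' x))"
    unfolding gp_density_def by (rule ext) (simp add: power2_eq_square field_simps)
  ultimately show ?thesis by simp
qed

lemma energy_eq_integral:
  assumes "weighted_sobolev p p'" "weighted_sobolev q q'"
  shows "energy \<epsilon> \<gamma> (p, q) = integral {0<..} (\<lambda>x. gp_density \<epsilon> \<gamma> x (p x) (q x) (p' x) (q' x))"
proof -
  have w: "weighted_sobolev p (weak_deriv p)" "weighted_sobolev q (weak_deriv q)"
    using assms weighted_sobolev_imp_mem weighted_sobolev_weak_deriv by blast+
  have "energy \<epsilon> \<gamma> (p, q) = (LINT x:{0<..}|lebesgue. gp_density \<epsilon> \<gamma> x (p x) (q x) (weak_deriv p x) (weak_deriv q x))"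
    unfolding energy_def gp_density_def by simp
  also have "\<dots> = integral {0<..} (\<lambda>x. gp_density \<epsilon> \<gamma> x (p x) (q x) (weak_deriv p x) (weak_deriv q x))"
    by (rule set_lebesgue_integral_eq_integral(2)[OF gp_density_integrable[OF w]])
  also have "\<dots> = integral {0<..} (\<lambda>x. gp_density \<epsilon> \<gamma> x (p x) (q x) (p' x) (q' x))"
  proof (rule integral_cong_AE_halfline)
    have "AE x in lebesgue. x > 0 \<longrightarrow> weak_deriv p x = p' x" "AE x in lebesgue. x > 0 \<longrightarrow> weak_deriv q x = q' x"
      using assms[THEN weighted_sobolevD(1)] by (auto intro: sobolev_imp_H1_halfline(2))
    then show "AE x in lebesgue. x > 0 \<longrightarrow> gp_density \<epsilon> \<gamma> x (p x) (q x) (weak_deriv p x) (weak_deriv q x)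
        = gp_density \<epsilon> \<gamma> x (p x) (q x) (p' x) (q' x)"
      by eventually_elim simp
  qed
  finally show ?thesis .
qed

text \<open>\<open>variation1\<close> to \<open>variation4\<close> are the coefficients of the
  powers of \<open>t\<close> in the density at \<open>(p + t h, q + t k)\<close>. They are spelled
  out as sums of exactly those products whose integrability is known.\<close>

definition variation1 where
  "variation1 \<epsilon> \<gamma> x p q p' q' h k h' k' = 2 * \<epsilon>\<^sup>2 * (p' * h') + 2 * \<epsilon>\<^sup>2 * (q' * k')
     + 2 * ((x\<^sup>2 - 1) * (p * h)) + 2 * ((x\<^sup>2 - 1) * (q * k))
     + 2 * (p * p * (p * h)) + 2 * (q * q * (q * k))
     + 2 * \<gamma> * (p * h * (q * q)) + 2 * \<gamma> * (p * p * (q * k))" for \<epsilon> :: real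

definition variation2 where
  "variation2 \<epsilon> \<gamma> x p q h k h' k' = \<epsilon>\<^sup>2 * (h' * h') + \<epsilon>\<^sup>2 * (k' * k')
     + (x\<^sup>2 - 1) * (h * h) + (x\<^sup>2 - 1) * (k * k)
     + 3 * (p * p * (h * h)) + 3 * (q * q * (k * k))
     + \<gamma> * (p * p * (k * k)) + \<gamma> * (q * q * (h * h)) + 4 * \<gamma> * (p * h * (q * k))" for \<epsilon> :: real

definition variation3 where
  "variation3 \<gamma> p q h k = 2 * (p * h * (h * h)) + 2 * (q * k * (k * k))
     + 2 * \<gamma> * (p * h * (k * k)) + 2 * \<gamma> * (q * k * (h * h))" for \<gamma> :: real

definition variation4 where
  "variation4 \<gamma> h k = 1/2 * (h * h * (h * h)) + 1/2 * (k * k * (k * k)) + \<gamma> * (h * h * (k * k))" for \<gamma> :: real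

lemma gp_density_expansion:
  "gp_density \<epsilon> \<gamma> x (p + t * h) (q + t * k) (p' + t * h') (q' + t * k') =
     gp_density \<epsilon> \<gamma> x p q p' q' + t * variation1 \<epsilon> \<gamma> x p q p' q' h k h' k'
     + t\<^sup>2 * variation2 \<epsilon> \<gamma> x p q h k h' k' + t^3 * variation3 \<gamma> p q h k + t^4 * variation4 \<gamma> h k"
  unfolding gp_density_def variation1_def variation2_def variation3_def variation4_def
  by (simp add: power2_eq_square power3_eq_cube power4_eq_xxxx field_simps)

lemma variations_integrable:
  assumes p: "weighted_sobolev p p'" and q: "weighted_sobolev q q'"
    and h: "weighted_sobolev h h'" and k: "weighted_sobolev k k'"
  shows "(\<lambda>x. variation1 \<epsilon> \<gamma> x (p x) (q x) (p' x) (q' x) (h x) (k x) (h' x) (k' x)) absolutely_integrable_on {0<..}"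
    and "(\<lambda>x. variation2 \<epsilon> \<gamma> x (p x) (q x) (h x) (k x) (h' x) (k' x)) absolutely_integrable_on {0<..}"
    and "(\<lambda>x. variation3 \<gamma> (p x) (q x) (h x) (k x)) absolutely_integrable_on {0<..}"
    and "(\<lambda>x. variation4 \<gamma> (h x) (k x)) absolutely_integrable_on {0<..}"
proof -
  note L = L2_mult_integrable[OF weighted_sobolevD(4) weighted_sobolevD(4)]
  note rules = set_integral_add(1) set_integrable_mult_right quadratic_monomial_integrable
    quartic_monomial_integrable L[OF p h] L[OF q k] L[OF h h] L[OF k k]
  show "(\<lambda>x. variation1 \<epsilon> \<gamma> x (p x) (q x) (p' x) (q' x) (h x) (k x) (h' x) (k' x)) absolutely_integrable_on {0<..}"
    unfolding variation1_def by (intro rules; rule p q h k)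
  show "(\<lambda>x. variation2 \<epsilon> \<gamma> x (p x) (q x) (h x) (k x) (h' x) (k' x)) absolutely_integrable_on {0<..}"
    unfolding variation2_def by (intro rules; rule p q h k)
  show "(\<lambda>x. variation3 \<gamma> (p x) (q x) (h x) (k x)) absolutely_integrable_on {0<..}"
    unfolding variation3_def by (intro rules; rule p q h k)
  show "(\<lambda>x. variation4 \<gamma> (h x) (k x)) absolutely_integrable_on {0<..}"
    unfolding variation4_def by (intro rules; rule p q h k)
qed

text \<open>A polynomial in \<open>t\<close> without remainder: its derivative at \<open>0\<close>
  isolates the first variation, and \<open>t = 1\<close> yields the energy of an arbitrary
  competitor.\<close>

lemma energy_expansion:
  assumes p: "weighted_sobolev p p'" and q: "weighted_sobolev q q'"
    and h: "weighted_sobolev h h'" and k: "weighted_sobolev k k'"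
  shows "energy \<epsilon> \<gamma> (\<lambda>x. p x + t * h x, \<lambda>x. q x + t * k x) = energy \<epsilon> \<gamma> (p, q)
     + t * integral {0<..} (\<lambda>x. variation1 \<epsilon> \<gamma> x (p x) (q x) (p' x) (q' x) (h x) (k x) (h' x) (k' x))
     + t\<^sup>2 * integral {0<..} (\<lambda>x. variation2 \<epsilon> \<gamma> x (p x) (q x) (h x) (k x) (h' x) (k' x))
     + t^3 * integral {0<..} (\<lambda>x. variation3 \<gamma> (p x) (q x) (h x) (k x))
     + t^4 * integral {0<..} (\<lambda>x. variation4 \<gamma> (h x) (k x))"
proof -
  note w = weighted_sobolev_add[OF p weighted_sobolev_cmult[OF h, of t]]
    weighted_sobolev_add[OF q weighted_sobolev_cmult[OF k, of t]]
  have i: "f integrable_on S" if "f absolutely_integrable_on S" for f :: "real \<Rightarrow> real" and S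
    using that by (simp add: absolutely_integrable_on_def)
  note ints = i[OF variations_integrable(1)[OF p q h k]] i[OF variations_integrable(2)[OF p q h k]]
    i[OF variations_integrable(3)[OF p q h k]] i[OF variations_integrable(4)[OF p q h k]]
    i[OF gp_density_integrable[OF p q]]
  show ?thesis
    unfolding energy_eq_integral[OF w] energy_eq_integral[OF p q] gp_density_expansion
    by (intro integral_unique has_integral_add has_integral_mult_right integrable_integral ints)
qed

lemma critical_point_first_variation:
  assumes crit: "critical_point \<epsilon> \<gamma> \<alpha> (p, q)"
    and p: "weighted_sobolev p p'" and q: "weighted_sobolev q q'"
    and h: "weighted_sobolev h h'" "h 0 = 0" and k: "weighted_sobolev k k'" "k 0 = 0"
  shows "integral {0<..} (\<lambda>x. variation1 \<epsilon> \<gamma> x (p x) (q x) (p' x) (q' x) (h x) (k x) (h' x) (k' x)) = 0"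
    (is "?c1 = 0")
proof -
  obtain c0 c2 c3 c4 where c: "\<And>t. energy \<epsilon> \<gamma> (\<lambda>x. p x + t * h x, \<lambda>x. q x + t * k x) = c0 + t * ?c1 + t\<^sup>2 * c2 + t^3 * c3 + t^4 * c4"
    using energy_expansion[OF p q h(1) k(1)] by blast
  have "(h, k) \<in> admissible 0" using admissibleI[OF h(1) k(1) h(2) k(2)] .
  then have "((\<lambda>t. energy \<epsilon> \<gamma> (\<lambda>x. p x + t * h x, \<lambda>x. q x + t * k x)) has_real_derivative 0) (at 0)"
    using crit unfolding critical_point_def by auto
  then have "((\<lambda>t. c0 + t * ?c1 + t\<^sup>2 * c2 + t^3 * c3 + t^4 * c4) has_real_derivative 0) (at 0)"
    unfolding c .
  moreover have "((\<lambda>t. c0 + t * ?c1 + t\<^sup>2 * c2 + t^3 * c3 + t^4 * c4) has_real_derivative ?c1) (at 0)"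
    by (auto intro!: derivative_eq_intros)
  ultimately show ?thesis by (rule DERIV_unique[symmetric])
qed


text \<open>\<open>halfline_eq\<close> leaves negative arguments free, so membership must not depend
  on them.\<close>

lemma weighted_sobolev_cong:
  assumes w: "weighted_sobolev f g" and eq: "\<And>x. x \<ge> 0 \<Longrightarrow> f x = F x"
  shows "weighted_sobolev F g"
proof -
  have L2: "F2 \<in> L2_halfline" if "f2 \<in> L2_halfline" "\<And>x. x \<ge> 0 \<Longrightarrow> f2 x = F2 x" for f2 F2 :: "real \<Rightarrow> real"
  proof -
    have "F2 \<in> borel_measurable (lebesgue_on {0<..})"
      using that by (subst measurable_cong[of _ _ f2]) (auto simp: L2_halfline_iff)
    moreover have "(\<lambda>x. (F2 x)\<^sup>2) absolutely_integrable_on {0<..}"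
      by (rule absolutely_integrable_spike[where f = "\<lambda>x. (f2 x)\<^sup>2" and S = "{}"])
         (use that in \<open>auto simp: L2_halfline_iff\<close>)
    ultimately show ?thesis by (simp add: L2_halfline_iff)
  qed
  note f = sobolevD[OF weighted_sobolevD(1)[OF w]]
  have "integral {0..x} g = F x - F 0" if "x \<ge> 0" for x
    using f(3)[OF that] eq[OF that] eq[of 0] by simp
  moreover have "F \<in> L2_halfline" using L2[OF f(1)] eq by blast
  moreover have "(\<lambda>x. \<bar>x\<bar> * F x) \<in> L2_halfline"
    using L2[OF weighted_sobolevD(2)[OF w], of "\<lambda>x. \<bar>x\<bar> * F x"] eq by simp
  ultimately show ?thesis using f(2) unfolding weighted_sobolev_def sobolev_def by blast
qed

lemma energy_halfline_eq:
  assumes "halfline_eq \<Phi> \<Psi>" "\<Psi> \<in> admissible \<alpha>"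
  shows "\<Phi> \<in> admissible \<alpha>" "energy \<epsilon> \<gamma> \<Phi> = energy \<epsilon> \<gamma> \<Psi>"
proof -
  obtain f1 f2 g1 g2 where eq: "\<Phi> = (f1, f2)" "\<Psi> = (g1, g2)" by (metis surj_pair)
  have e: "g1 x = f1 x" "g2 x = f2 x" if "x \<ge> 0" for x
    using assms(1) that unfolding eq halfline_eq_def by auto
  note g = admissibleD[OF assms(2)[unfolded eq]]
  have w: "weighted_sobolev f1 (weak_deriv g1)" "weighted_sobolev f2 (weak_deriv g2)"
    using weighted_sobolev_cong[OF g(1), of f1] weighted_sobolev_cong[OF g(2), of f2] e by blast+
  show "\<Phi> \<in> admissible \<alpha>" unfolding eq
    by (rule admissibleI[OF w]) (use g e in auto)
  show "energy \<epsilon> \<gamma> \<Phi> = energy \<epsilon> \<gamma> \<Psi>"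
    unfolding eq energy_eq_integral[OF w] energy_eq_integral[OF g(1,2)]
    by (rule integral_cong) (simp add: e)
qed

lemma energy_swap:
  assumes "(p, q) \<in> admissible \<alpha>"
  shows "(q, p) \<in> admissible \<alpha>" "energy \<epsilon> \<gamma> (q, p) = energy \<epsilon> \<gamma> (p, q)"
proof -
  note w = admissibleD[OF assms]
  show "(q, p) \<in> admissible \<alpha>" by (rule admissibleI[OF w(2,1,4,3)])
  show "energy \<epsilon> \<gamma> (q, p) = energy \<epsilon> \<gamma> (p, q)"
    unfolding energy_eq_integral[OF w(1,2)] energy_eq_integral[OF w(2,1)] gp_density_def
    by (rule integral_cong) (simp add: add_ac mult_ac)
qed

section \<open>Ordered critical points\<close>

locale ordered_critical_point =
  fixes \<epsilon> \<gamma> \<alpha> :: real and p q :: "real \<Rightarrow> real"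
  assumes eps: "\<epsilon> > 0" and alpha: "\<alpha> > 0"
    and crit: "critical_point \<epsilon> \<gamma> \<alpha> (p, q)"
    and ordered: "\<And>x. x > 0 \<Longrightarrow> p x > q x \<and> q x > 0"
begin

abbreviation p' where "p' \<equiv> weak_deriv p"
abbreviation q' where "q' \<equiv> weak_deriv q"

definition a where "a x = p x + q x"
definition b where "b x = p x - q x"
text \<open>Adding and subtracting the two equations factors out \<open>a\<close> and
  \<open>b\<close>: \<open>c = \<gamma> - 1\<close> gives the potential that belongs to
  \<open>a\<close>, and \<open>c = 1 - \<gamma>\<close> the one that belongs to
  \<open>b\<close>.\<close>

definition potential where "potential c x = x\<^sup>2 - 1 + (p x)\<^sup>2 + (q x)\<^sup>2 + c * (p x * q x)"

lemma pq_admissible: "(p, q) \<in> admissible \<alpha>"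
  using crit unfolding critical_point_def by simp

lemma pq: "weighted_sobolev p p'" "weighted_sobolev q q'" "p 0 = \<alpha>" "q 0 = \<alpha>"
  using admissibleD[OF pq_admissible] by auto

lemma ab_sobolev:
  "weighted_sobolev a (\<lambda>x. p' x + q' x)" "weighted_sobolev b (\<lambda>x. p' x - q' x)"
  unfolding a_def[abs_def] b_def[abs_def]
  using weighted_sobolev_add[OF pq(1,2)] weighted_sobolev_diff[OF pq(1,2)] by auto

lemma a_0: "a 0 = 2 * \<alpha>" and b_0: "b 0 = 0"
  unfolding a_def b_def using pq by auto

lemma ab_pos: "x > 0 \<Longrightarrow> a x > 0" "x > 0 \<Longrightarrow> b x > 0"
  unfolding a_def b_def using ordered[of x] by auto

lemma a_pos: "x \<ge> 0 \<Longrightarrow> a x > 0"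
  using ab_pos(1)[of x] a_0 alpha by (cases "x = 0") auto

lemma potential_continuous: "continuous_on {0..} (potential c)"
  unfolding potential_def using pq(1,2)[THEN weighted_sobolevD(5)] by (intro continuous_intros)

lemma potential_bound:
  obtains M where "\<And>x. x \<ge> 0 \<Longrightarrow> \<bar>potential c x\<bar> \<le> x\<^sup>2 + M"
proof -
  obtain B1 where B1: "B1 \<ge> 0" "\<And>x. x \<ge> 0 \<Longrightarrow> \<bar>p x\<bar> \<le> B1"
    using sobolev_bounded[OF weighted_sobolevD(1)[OF pq(1)]] by blast
  obtain B2 where B2: "B2 \<ge> 0" "\<And>x. x \<ge> 0 \<Longrightarrow> \<bar>q x\<bar> \<le> B2"
    using sobolev_bounded[OF weighted_sobolevD(1)[OF pq(2)]] by blast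
  show ?thesis
  proof
    fix x :: real assume x: "x \<ge> 0"
    have "\<bar>p x\<bar>\<^sup>2 \<le> B1\<^sup>2" "\<bar>q x\<bar>\<^sup>2 \<le> B2\<^sup>2"
      by (rule power_mono[OF B1(2)[OF x] abs_ge_zero], rule power_mono[OF B2(2)[OF x] abs_ge_zero])
    then have "(p x)\<^sup>2 \<le> B1\<^sup>2" "(q x)\<^sup>2 \<le> B2\<^sup>2" by simp_all
    moreover have "\<bar>c * (p x * q x)\<bar> \<le> \<bar>c\<bar> * (B1 * B2)"
      unfolding abs_mult using B1 B2 x by (intro mult_mono) auto
    moreover have "0 \<le> x\<^sup>2" "0 \<le> (p x)\<^sup>2" "0 \<le> (q x)\<^sup>2" by simp_all
    ultimately show "\<bar>potential c x\<bar> \<le> x\<^sup>2 + (1 + B1\<^sup>2 + B2\<^sup>2 + \<bar>c\<bar> * (B1 * B2))"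
      unfolding potential_def abs_le_iff by linarith
  qed
qed

text \<open>The perturbation directions \<open>(\<eta>, \<eta>)\<close> and
  \<open>(\<eta>, -\<eta>)\<close> separate the equations for \<open>a\<close> and
  \<open>b\<close>.\<close>

lemma ab_weak_equation:
  assumes "sobolev \<eta> \<kappa>" "(\<lambda>x. \<bar>x\<bar> * \<eta> x) \<in> L2_halfline" "\<eta> 0 = 0"
  shows "integral {0<..} (\<lambda>x. \<epsilon>\<^sup>2 * ((p' x + q' x) * \<kappa> x) + potential (\<gamma> - 1) x * (a x * \<eta> x)) = 0"
    and "integral {0<..} (\<lambda>x. \<epsilon>\<^sup>2 * ((p' x - q' x) * \<kappa> x) + potential (1 - \<gamma>) x * (b x * \<eta> x)) = 0"
proof -
  have \<eta>: "weighted_sobolev \<eta> \<kappa>" using assms unfolding weighted_sobolev_def by blast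
  have m\<eta>: "weighted_sobolev (\<lambda>x. -1 * \<eta> x) (\<lambda>x. -1 * \<kappa> x)" by (rule weighted_sobolev_cmult[OF \<eta>])
  have "integral {0<..} (\<lambda>x. variation1 \<epsilon> \<gamma> x (p x) (q x) (p' x) (q' x) (\<eta> x) (\<eta> x) (\<kappa> x) (\<kappa> x)) = 0"
    by (rule critical_point_first_variation[OF crit pq(1,2) \<eta> assms(3) \<eta> assms(3)])
  moreover have "variation1 \<epsilon> \<gamma> x (p x) (q x) (p' x) (q' x) (\<eta> x) (\<eta> x) (\<kappa> x) (\<kappa> x)
      = 2 * (\<epsilon>\<^sup>2 * ((p' x + q' x) * \<kappa> x) + potential (\<gamma> - 1) x * (a x * \<eta> x))" for x
    unfolding variation1_def potential_def a_def by (simp add: power2_eq_square algebra_simps)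
  ultimately show "integral {0<..} (\<lambda>x. \<epsilon>\<^sup>2 * ((p' x + q' x) * \<kappa> x) + potential (\<gamma> - 1) x * (a x * \<eta> x)) = 0"
    by (simp only: Henstock_Kurzweil_Integration.integral_mult_right)
  have "integral {0<..} (\<lambda>x. variation1 \<epsilon> \<gamma> x (p x) (q x) (p' x) (q' x) (\<eta> x) (-1 * \<eta> x) (\<kappa> x) (-1 * \<kappa> x)) = 0"
    by (rule critical_point_first_variation[OF crit pq(1,2) \<eta> assms(3) m\<eta>]) (simp add: assms(3))
  moreover have "variation1 \<epsilon> \<gamma> x (p x) (q x) (p' x) (q' x) (\<eta> x) (-1 * \<eta> x) (\<kappa> x) (-1 * \<kappa> x)
      = 2 * (\<epsilon>\<^sup>2 * ((p' x - q' x) * \<kappa> x) + potential (1 - \<gamma>) x * (b x * \<eta> x))" for x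
    unfolding variation1_def potential_def b_def by (simp add: power2_eq_square algebra_simps)
  ultimately show "integral {0<..} (\<lambda>x. \<epsilon>\<^sup>2 * ((p' x - q' x) * \<kappa> x) + potential (1 - \<gamma>) x * (b x * \<eta> x)) = 0"
    by (simp only: Henstock_Kurzweil_Integration.integral_mult_right)
qed

lemma a_equation:
  assumes "x > 0"
  shows "(a has_real_derivative deriv a x) (at x)"
    "(deriv a has_real_derivative potential (\<gamma> - 1) x * a x / \<epsilon>\<^sup>2) (at x)"
  by (rule weak_solution_regularity[OF eps weighted_sobolevD(1)[OF ab_sobolev(1)]
        potential_continuous ab_weak_equation(1) assms]; assumption)+

lemma b_equation:
  assumes "x > 0"
  shows "(b has_real_derivative deriv b x) (at x)"
    "(deriv b has_real_derivative potential (1 - \<gamma>) x * b x / \<epsilon>\<^sup>2) (at x)"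
  by (rule weak_solution_regularity[OF eps weighted_sobolevD(1)[OF ab_sobolev(2)]
        potential_continuous ab_weak_equation(2) assms]; assumption)+

lemma quadratic_forms_nonneg:
  assumes "weighted_sobolev \<eta> \<kappa>" "\<eta> 0 = 0"
  shows "0 \<le> integral {0<..} (\<lambda>x. \<epsilon>\<^sup>2 * (\<kappa> x)\<^sup>2 + potential (\<gamma> - 1) x * (\<eta> x)\<^sup>2)"
    and "0 \<le> integral {0<..} (\<lambda>x. \<epsilon>\<^sup>2 * (\<kappa> x)\<^sup>2 + potential (1 - \<gamma>) x * (\<eta> x)\<^sup>2)"
proof -
  note \<eta> = weighted_sobolevD(1,2)[OF assms(1)]
  obtain M where M: "\<And>x. x \<ge> 0 \<Longrightarrow> \<bar>potential (\<gamma> - 1) x\<bar> \<le> x\<^sup>2 + M" using potential_bound by blast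
  show "0 \<le> integral {0<..} (\<lambda>x. \<epsilon>\<^sup>2 * (\<kappa> x)\<^sup>2 + potential (\<gamma> - 1) x * (\<eta> x)\<^sup>2)"
    by (rule positive_solution_quadratic_form_nonneg[OF eps potential_continuous M a_equation ab_pos(1) \<eta> assms(2)])
  obtain M where M: "\<And>x. x \<ge> 0 \<Longrightarrow> \<bar>potential (1 - \<gamma>) x\<bar> \<le> x\<^sup>2 + M" using potential_bound by blast
  show "0 \<le> integral {0<..} (\<lambda>x. \<epsilon>\<^sup>2 * (\<kappa> x)\<^sup>2 + potential (1 - \<gamma>) x * (\<eta> x)\<^sup>2)"
    by (rule positive_solution_quadratic_form_nonneg[OF eps potential_continuous M b_equation ab_pos(2) \<eta> assms(2)])
qed

lemma gamma_gt_1: "\<gamma> > 1"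
proof (rule ccontr)
  assume "\<not> \<gamma> > 1"
  then have g1: "\<gamma> \<le> 1" by simp
  define W where "W x = a x * deriv b x - deriv a x * b x" for x
  \<comment> \<open>\<open>\<epsilon>^2 W'\<close> is \<open>a b\<close> times the difference of the
    two potentials, which is \<open>2 (1 - \<gamma>) p q\<close>.\<close>
  have dW: "(W has_real_derivative 2 * (1 - \<gamma>) * (p x * q x) * (a x * b x) / \<epsilon>\<^sup>2) (at x)" if x: "x > 0" for x
  proof -
    have "(W has_real_derivative (deriv a x * deriv b x + (potential (1 - \<gamma>) x * b x / \<epsilon>\<^sup>2) * a x)
        - ((potential (\<gamma> - 1) x * a x / \<epsilon>\<^sup>2) * b x + deriv b x * deriv a x)) (at x)"
      unfolding W_def[abs_def] by (intro DERIV_diff DERIV_mult a_equation b_equation x)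
    moreover have "(deriv a x * deriv b x + (potential (1 - \<gamma>) x * b x / \<epsilon>\<^sup>2) * a x)
        - ((potential (\<gamma> - 1) x * a x / \<epsilon>\<^sup>2) * b x + deriv b x * deriv a x)
        = 2 * (1 - \<gamma>) * (p x * q x) * (a x * b x) / \<epsilon>\<^sup>2"
      unfolding potential_def using eps by (simp add: field_simps)
    ultimately show ?thesis by simp
  qed
  have mono: "W x \<le> W y" if "0 < x" "x \<le> y" for x y
  proof (rule DERIV_nonneg_imp_nondecreasing[OF that(2)])
    fix z assume z: "x \<le> z" "z \<le> y"
    then have "z > 0" using that by simp
    moreover from this have "0 \<le> 2 * (1 - \<gamma>) * (p z * q z) * (a z * b z) / \<epsilon>\<^sup>2"
      using ab_pos[of z] ordered[of z] g1 by (intro divide_nonneg_nonneg mult_nonneg_nonneg) auto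
    ultimately show "\<exists>y. (W has_real_derivative y) (at z) \<and> 0 \<le> y" using dW by blast
  qed
  have cont: "continuous_on {0<..} (deriv a)" "continuous_on {0<..} (deriv b)"
    by (intro continuous_at_imp_continuous_on ballI; auto intro: DERIV_isCont a_equation(2) b_equation(2))+
  have W_le: "W x0 \<le> 0" if x0: "x0 > 0" for x0
  proof (rule ccontr)
    assume "\<not> W x0 \<le> 0"
    then have c: "W x0 > 0" by simp
    define f where "f x = a x * (p' x - q' x) - (p' x + q' x) * b x" for x
    have f: "f absolutely_integrable_on {0<..}"
      unfolding f_def[abs_def]
      by (intro set_integral_diff(1) L2_mult_integrable ab_sobolev[THEN weighted_sobolevD(3)] ab_sobolev[THEN weighted_sobolevD(4)])
    \<comment> \<open>\<open>f\<close> is integrable but known to agree with \<open>W\<close> only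
      almost everywhere beyond \<open>x0\<close>. \<open>F\<close> uses \<open>W\<close> itself
      there, so that the small value found is a value of \<open>W\<close>.\<close>
    define F where "F x = (if x \<ge> x0 then W x else f x)" for x
    have "AE x in lebesgue. x \<in> {x0..} \<longrightarrow> p' x + q' x = deriv a x"
      by (rule sobolev_deriv_AE[OF weighted_sobolevD(1)[OF ab_sobolev(1)] a_equation(1) cont(1) x0])
    moreover have "AE x in lebesgue. x \<in> {x0..} \<longrightarrow> p' x - q' x = deriv b x"
      by (rule sobolev_deriv_AE[OF weighted_sobolevD(1)[OF ab_sobolev(2)] b_equation(1) cont(2) x0])
    ultimately have "AE x in lebesgue. F x = f x"
      by eventually_elim (auto simp: F_def W_def f_def)
    then obtain N where N: "N \<in> null_sets lebesgue" "{x \<in> space lebesgue. F x \<noteq> f x} \<subseteq> N"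
      unfolding eventually_ae_filter by blast
    have "F absolutely_integrable_on {0<..}"
      by (rule absolutely_integrable_spike[OF f, of N]) (use N in \<open>auto simp: negligible_iff_null_sets\<close>)
    from integrable_halfline_small_values[OF this c, of x0]
    obtain x where "x \<ge> x0" "F x < W x0" by blast
    then show False using mono[OF x0, of x] by (simp add: F_def)
  qed
  define r where "r x = b x / a x" for x
  have dr: "(r has_real_derivative W x / (a x * a x)) (at x)" if x: "x > 0" for x
  proof -
    have "(r has_real_derivative (deriv b x * a x - b x * deriv a x) / (a x * a x)) (at x)"
      unfolding r_def[abs_def] using ab_pos(1)[OF x] by (intro DERIV_divide a_equation b_equation x) auto
    then show ?thesis unfolding W_def by (simp add: mult_ac)
  qed
  have anti: "r y \<le> r x" if "0 < x" "x \<le> y" for x y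
  proof (rule DERIV_nonpos_imp_nonincreasing[OF that(2)])
    fix z assume "x \<le> z" "z \<le> y"
    then have z: "z > 0" using that by simp
    have "W z / (a z * a z) \<le> 0" using W_le[OF z] by (simp add: divide_nonpos_nonneg)
    then show "\<exists>y. (r has_real_derivative y) (at z) \<and> y \<le> 0" using dr[OF z] by blast
  qed
  \<comment> \<open>\<open>a 0 = 2 \<alpha>\<close> is positive, so the quotient stays continuous at
    the origin and takes the value \<open>0\<close> there.\<close>
  have cr: "continuous_on {0..} r"
    unfolding r_def using a_pos
    by (intro continuous_intros ab_sobolev[THEN weighted_sobolevD(5)]) force
  have "r 1 \<le> r 0"
    by (rule continuous_ge_on_closure[of "{0<..<1}" r 0 "r 1"])
       (use anti in \<open>auto intro: continuous_on_subset[OF cr]\<close>)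
  then show False using ab_pos[of 1] b_0 by (simp add: r_def divide_le_0_iff)
qed

text \<open>
  The form \<open>1/16 * ((\<gamma> + 1) * (A\<^sup>2 + B\<^sup>2) + 2 * (3 - \<gamma>) * A * B)\<close> in the increments \<open>A\<close> of \<open>a\<^sup>2\<close> and \<open>B\<close> of \<open>b\<^sup>2\<close>,
  written as a sum of squares.
\<close>

definition defect :: "real \<Rightarrow> real \<Rightarrow> real \<Rightarrow> real" where
  "defect x h k = 1/8 * (((a x + (h + k))\<^sup>2 - (a x)\<^sup>2) + ((b x + (h - k))\<^sup>2 - (b x)\<^sup>2))\<^sup>2
     + (\<gamma> - 1) / 16 * (((a x + (h + k))\<^sup>2 - (a x)\<^sup>2) - ((b x + (h - k))\<^sup>2 - (b x)\<^sup>2))\<^sup>2"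

text \<open>With \<open>A = a^2\<close>, \<open>B = b^2\<close> one has
  \<open>p^2 + q^2 = (A + B) / 2\<close> and \<open>p q = (A - B) / 4\<close>, so the interaction is
  \<open>1/8 (A + B)^2 + (\<gamma> - 1)/16 (A - B)^2\<close>. Since this is quadratic, its
  second-order part is the same form at the increments, namely \<open>defect\<close>. The factors
  \<open>1/2\<close> reflect that the squares of the derivatives of \<open>p\<close> and
  \<open>q\<close> add up to half the sum of those of \<open>a\<close> and \<open>b\<close>.\<close>

lemma variation_decomposition:
  "variation2 \<epsilon> \<gamma> x (p x) (q x) h k h' k' + (variation3 \<gamma> (p x) (q x) h k + variation4 \<gamma> h k) =
     1/2 * (\<epsilon>\<^sup>2 * (h' + k')\<^sup>2 + potential (\<gamma> - 1) x * (h + k)\<^sup>2)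
     + 1/2 * (\<epsilon>\<^sup>2 * (h' - k')\<^sup>2 + potential (1 - \<gamma>) x * (h - k)\<^sup>2) + defect x h k"
  unfolding variation2_def variation3_def variation4_def potential_def defect_def a_def b_def
  by (simp add: power2_eq_square field_simps)

text \<open>At \<open>t = 1\<close> the first variation drops out, and both quadratic forms are
  nonnegative because the perturbations \<open>h + k\<close> of \<open>a\<close> and
  \<open>h - k\<close> of \<open>b\<close> vanish at \<open>0\<close>.\<close>

lemma energy_lower_bound:
  assumes h: "weighted_sobolev h h'" "h 0 = 0" and k: "weighted_sobolev k k'" "k 0 = 0"
  shows "(\<lambda>x. defect x (h x) (k x)) absolutely_integrable_on {0<..}" (is ?A)
    and "energy \<epsilon> \<gamma> (p, q) + integral {0<..} (\<lambda>x. defect x (h x) (k x))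
      \<le> energy \<epsilon> \<gamma> (\<lambda>x. p x + h x, \<lambda>x. q x + k x)" (is ?B)
proof -
  note hk = weighted_sobolev_add[OF h(1) k(1)] weighted_sobolev_diff[OF h(1) k(1)]
  define Qa where "Qa x = \<epsilon>\<^sup>2 * (h' x + k' x)\<^sup>2 + potential (\<gamma> - 1) x * (h x + k x)\<^sup>2" for x
  define Qb where "Qb x = \<epsilon>\<^sup>2 * (h' x - k' x)\<^sup>2 + potential (1 - \<gamma>) x * (h x - k x)\<^sup>2" for x
  define R where "R x = variation2 \<epsilon> \<gamma> x (p x) (q x) (h x) (k x) (h' x) (k' x)
      + (variation3 \<gamma> (p x) (q x) (h x) (k x) + variation4 \<gamma> (h x) (k x))" for x
  have form: "(\<lambda>x. \<epsilon>\<^sup>2 * (\<kappa> x)\<^sup>2 + potential c x * (\<eta> x)\<^sup>2) absolutely_integrable_on {0<..}"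
    if w: "weighted_sobolev \<eta> \<kappa>" for \<eta> \<kappa> c
  proof -
    obtain M where M: "\<And>x. x \<ge> 0 \<Longrightarrow> \<bar>potential c x\<bar> \<le> x\<^sup>2 + M" using potential_bound by blast
    have "(\<lambda>x. \<epsilon>\<^sup>2 * (\<kappa> x * \<kappa> x) + potential c x * (\<eta> x * \<eta> x)) absolutely_integrable_on {0<..}"
      by (intro set_integral_add(1) set_integrable_mult_right L2_mult_integrable
          L2_potential_integrable[OF potential_continuous M] weighted_sobolevD(2,3,4)[OF w])
    then show ?thesis by (simp add: power2_eq_square)
  qed
  have Qai: "Qa absolutely_integrable_on {0<..}" and Qbi: "Qb absolutely_integrable_on {0<..}"
    unfolding Qa_def[abs_def] Qb_def[abs_def] using form[OF hk(1)] form[OF hk(2)] by auto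
  note var = variations_integrable[OF pq(1,2) h(1) k(1)]
  have Ri: "R absolutely_integrable_on {0<..}"
    unfolding R_def[abs_def] by (intro set_integral_add(1) var)
  have R: "R x = 1/2 * Qa x + 1/2 * Qb x + defect x (h x) (k x)" for x
    unfolding R_def Qa_def Qb_def by (rule variation_decomposition)
  \<comment> \<open>\<open>defect\<close> is integrable as a difference of terms already known to
    be.\<close>
  have "(\<lambda>x. R x - (1/2 * Qa x + 1/2 * Qb x)) absolutely_integrable_on {0<..}"
    by (intro set_integral_diff(1) set_integral_add(1) set_integrable_mult_right Ri Qai Qbi)
  then show d: ?A by (simp add: R)
  have i: "f integrable_on {0<..}" if "f absolutely_integrable_on {0<..}" for f :: "real \<Rightarrow> real"
    using that by (simp add: absolutely_integrable_on_def)
  have "integral {0<..} R = integral {0<..} (\<lambda>x. variation2 \<epsilon> \<gamma> x (p x) (q x) (h x) (k x) (h' x) (k' x))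
      + (integral {0<..} (\<lambda>x. variation3 \<gamma> (p x) (q x) (h x) (k x)) + integral {0<..} (\<lambda>x. variation4 \<gamma> (h x) (k x)))"
    unfolding R_def by (intro integral_unique has_integral_add integrable_integral i var)
  moreover have "integral {0<..} (\<lambda>x. variation1 \<epsilon> \<gamma> x (p x) (q x) (p' x) (q' x) (h x) (k x) (h' x) (k' x)) = 0"
    by (rule critical_point_first_variation[OF crit pq(1,2) h k])
  ultimately have "energy \<epsilon> \<gamma> (\<lambda>x. p x + h x, \<lambda>x. q x + k x) = energy \<epsilon> \<gamma> (p, q) + integral {0<..} R"
    using energy_expansion[OF pq(1,2) h(1) k(1), of \<epsilon> \<gamma> 1] by simp
  moreover have "integral {0<..} R = 1/2 * integral {0<..} Qa + 1/2 * integral {0<..} Qb + integral {0<..} (\<lambda>x. defect x (h x) (k x))"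
    unfolding R[abs_def] by (intro integral_unique has_integral_add has_integral_mult_right integrable_integral i Qai Qbi d)
  moreover have "0 \<le> integral {0<..} Qa" "0 \<le> integral {0<..} Qb"
    unfolding Qa_def Qb_def using quadratic_forms_nonneg(1)[OF hk(1)] quadratic_forms_nonneg(2)[OF hk(2)] h(2) k(2) by auto
  ultimately show ?B by simp
qed

lemma defect_nonneg: "0 \<le> defect x h k"
  unfolding defect_def using gamma_gt_1 by simp

lemma defect_eq_0:
  assumes "defect x h k = 0"
  shows "(a x + (h + k))\<^sup>2 = (a x)\<^sup>2" "(b x + (h - k))\<^sup>2 = (b x)\<^sup>2"
proof -
  define A B where "A = (a x + (h + k))\<^sup>2 - (a x)\<^sup>2" and "B = (b x + (h - k))\<^sup>2 - (b x)\<^sup>2"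
  have "1/8 * (A + B)\<^sup>2 + (\<gamma> - 1) / 16 * (A - B)\<^sup>2 = 0"
    using assms unfolding defect_def A_def B_def .
  moreover have "0 \<le> 1/8 * (A + B)\<^sup>2" "0 \<le> (\<gamma> - 1) / 16 * (A - B)\<^sup>2" using gamma_gt_1 by simp_all
  ultimately have "1/8 * (A + B)\<^sup>2 = 0" "(\<gamma> - 1) / 16 * (A - B)\<^sup>2 = 0" by linarith+
  then have "A + B = 0" "A - B = 0" using gamma_gt_1 by auto
  then have "A = 0" "B = 0" by linarith+
  then show "(a x + (h + k))\<^sup>2 = (a x)\<^sup>2" "(b x + (h - k))\<^sup>2 = (b x)\<^sup>2" unfolding A_def B_def by auto
qed

lemma energy_minimal:
  assumes "\<Phi> \<in> admissible \<alpha>"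
  shows "energy \<epsilon> \<gamma> (p, q) \<le> energy \<epsilon> \<gamma> \<Phi>" (is ?A)
    and "energy \<epsilon> \<gamma> \<Phi> \<le> energy \<epsilon> \<gamma> (p, q) \<Longrightarrow> halfline_eq \<Phi> (p, q) \<or> halfline_eq \<Phi> (q, p)" (is "_ \<Longrightarrow> ?B")
proof -
  obtain f1 f2 where \<Phi>: "\<Phi> = (f1, f2)" by (metis surj_pair)
  note f = admissibleD[OF assms[unfolded \<Phi>]]
  define h k where "h x = f1 x - p x" and "k x = f2 x - q x" for x
  have hk: "weighted_sobolev h (\<lambda>x. weak_deriv f1 x - p' x)" "h 0 = 0"
    "weighted_sobolev k (\<lambda>x. weak_deriv f2 x - q' x)" "k 0 = 0"
    unfolding h_def[abs_def] k_def[abs_def] using f pq by (auto intro: weighted_sobolev_diff)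
  define d where "d x = defect x (h x) (k x)" for x
  have di: "d absolutely_integrable_on {0<..}" unfolding d_def[abs_def] by (rule energy_lower_bound(1)[OF hk])
  have ge: "energy \<epsilon> \<gamma> (p, q) + integral {0<..} d \<le> energy \<epsilon> \<gamma> \<Phi>"
    using energy_lower_bound(2)[OF hk] unfolding \<Phi> d_def[abs_def] h_def k_def by simp
  have dn: "0 \<le> d x" for x unfolding d_def by (rule defect_nonneg)
  have dint: "d integrable_on {0<..}" using di by (simp add: absolutely_integrable_on_def)
  have "0 \<le> integral {0<..} d" by (rule integral_nonneg[OF dint]) (simp add: dn)
  then show ?A using ge by simp
  assume "energy \<epsilon> \<gamma> \<Phi> \<le> energy \<epsilon> \<gamma> (p, q)"
  then have d_le: "integral {0<..} d \<le> 0" using ge by simp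
  have cd: "continuous_on {0..} d"
    unfolding d_def defect_def
    by (intro continuous_intros ab_sobolev[THEN weighted_sobolevD(5)] hk(1,3)[THEN weighted_sobolevD(5)])
  \<comment> \<open>Continuity upgrades the vanishing integral of a nonnegative function to
    vanishing at every point.\<close>
  have d0: "d x = 0" if x: "x > 0" for x
  proof -
    have sub: "{x..x+1} \<subseteq> {0<..}" using x by auto
    have i: "d integrable_on {x..x+1}" using integrable_on_subinterval[OF dint sub] .
    have "integral {x..x+1} d \<le> integral {0<..} d" by (rule integral_subset_le[OF sub i dint]) (simp add: dn)
    moreover have "0 \<le> integral {x..x+1} d" by (rule integral_nonneg[OF i]) (simp add: dn)
    ultimately have "integral {x..x+1} d = 0" using d_le by linarith
    moreover have "continuous_on {x..x+1} d" by (rule continuous_on_subset[OF cd]) (use x in auto)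
    ultimately show ?thesis using integral_eq_0_iff[of x "x+1" d] dn by simp
  qed
  define s m where "s x = f1 x + f2 x" and "m x = f1 x - f2 x" for x
  have cs: "continuous_on {0..} s" and cm: "continuous_on {0..} m"
    unfolding s_def m_def using f(1,2)[THEN weighted_sobolevD(5)] by (auto intro: continuous_intros)
  have s2: "(s x)\<^sup>2 = (a x)\<^sup>2" and m2: "(m x)\<^sup>2 = (b x)\<^sup>2" if x: "x > 0" for x
    using defect_eq_0[OF d0[OF x, unfolded d_def]] unfolding s_def m_def a_def b_def h_def k_def
    by (simp_all add: algebra_simps)
  \<comment> \<open>The squares fix \<open>s\<close> and \<open>m\<close> only up to a sign at each
    point; continuity and the absence of zeros make that sign constant.\<close>
  have nonzero_sign: "(\<forall>x>0. 0 < g x) \<or> (\<forall>x>0. g x < 0)"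
    if c: "continuous_on {0..} g" and nz: "\<And>x. x > 0 \<Longrightarrow> g x \<noteq> 0" for g :: "real \<Rightarrow> real"
  proof (rule ccontr)
    assume "\<not> ?thesis"
    then obtain x y where xy: "x > 0" "y > 0" "g x < 0" "0 < g y"
      using nz by (meson linorder_neqE_linordered_idom)
    have "connected ({0<..} :: real set)" by simp
    then have conn: "connected (g ` {0<..})"
      by (rule connected_continuous_image[rotated]) (auto intro: continuous_on_subset[OF c])
    have mem: "g x \<in> g ` {0<..}" "g y \<in> g ` {0<..}" using xy(1,2) by simp_all
    have "0 \<in> g ` {0<..}"
      by (rule connectedD_interval[OF conn mem less_imp_le[OF xy(3)] less_imp_le[OF xy(4)]])
    then show False using nz by auto
  qed
  have sa: "s x = a x" if x: "x \<ge> 0" for x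
  proof (cases "x = 0")
    case True then show ?thesis using f a_0 by (simp add: s_def)
  next
    case False
    with x have x: "x > 0" by simp
    have nz: "s y \<noteq> 0" if "y > 0" for y using s2[OF that] ab_pos(1)[OF that] by auto
    \<comment> \<open>The boundary value \<open>s 0 = 2 \<alpha>\<close> excludes the negative sign.
      For \<open>m\<close> the value at \<open>0\<close> is zero, so both signs remain and give the
      two minimizers.\<close>
    have "\<not> (\<forall>y>0. s y < 0)"
    proof
      assume "\<forall>y>0. s y < 0"
      then have "s 0 \<le> 0"
        by (intro continuous_le_on_closure[of "{0<..<1}" s 0 0]) (auto intro: continuous_on_subset[OF cs] less_imp_le)
      then show False using f alpha by (simp add: s_def)
    qed
    then have "0 < s x" using nonzero_sign[OF cs nz] x by blast
    from power2_eq_imp_eq[OF s2[OF x] less_imp_le[OF this] less_imp_le[OF ab_pos(1)[OF x]]]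
    show ?thesis .
  qed
  have m0: "m 0 = 0" using f by (simp add: m_def)
  have "(\<forall>x>0. 0 < m x) \<or> (\<forall>x>0. m x < 0)"
    by (rule nonzero_sign[OF cm]) (use m2 ab_pos(2) in force)
  then show ?B
  proof
    assume pos: "\<forall>x>0. 0 < m x"
    have mb: "m x = b x" if "x \<ge> 0" for x
    proof (cases "x = 0")
      case False
      with that have x: "x > 0" by simp
      show ?thesis
        by (rule power2_eq_imp_eq[OF m2[OF x] less_imp_le[OF pos[rule_format, OF x]] less_imp_le[OF ab_pos(2)[OF x]]])
    qed (simp add: m0 b_0)
    have "f1 x = p x \<and> f2 x = q x" if "x \<ge> 0" for x
      using sa[OF that] mb[OF that] unfolding s_def m_def a_def b_def by linarith
    then show ?thesis unfolding \<Phi> halfline_eq_def by simp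
  next
    assume neg: "\<forall>x>0. m x < 0"
    have mb: "- m x = b x" if "x \<ge> 0" for x
    proof (cases "x = 0")
      case False
      with that have x: "x > 0" by simp
      have "(- m x)\<^sup>2 = (b x)\<^sup>2" using m2[OF x] by simp
      moreover have "0 \<le> - m x" using neg[rule_format, OF x] by linarith
      ultimately show ?thesis using less_imp_le[OF ab_pos(2)[OF x]] by (rule power2_eq_imp_eq)
    qed (simp add: m0 b_0)
    have "f1 x = q x \<and> f2 x = p x" if "x \<ge> 0" for x
      using sa[OF that] mb[OF that] unfolding s_def m_def a_def b_def by linarith
    then show ?thesis unfolding \<Phi> halfline_eq_def by simp
  qed
qed

end

theorem theorem4:
  fixes \<epsilon> \<gamma> \<alpha> :: real and \<psi>1 \<psi>2 :: "real \<Rightarrow> real"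
  assumes "\<epsilon> > 0" and "\<gamma> > 0" and "\<alpha> > 0"
    and "critical_point \<epsilon> \<gamma> \<alpha> (\<psi>1, \<psi>2)"
    and "\<And>x. x > 0 \<Longrightarrow> \<psi>1 x > \<psi>2 x \<and> \<psi>2 x > 0"
  shows "global_minimizer \<epsilon> \<gamma> \<alpha> \<Phi> \<longleftrightarrow>
           halfline_eq \<Phi> (\<psi>1, \<psi>2) \<or> halfline_eq \<Phi> (\<psi>2, \<psi>1)"
proof -
  interpret ordered_critical_point \<epsilon> \<gamma> \<alpha> \<psi>1 \<psi>2
    using assms by unfold_locales auto
  show ?thesis
  proof
    assume "global_minimizer \<epsilon> \<gamma> \<alpha> \<Phi>"
    then show "halfline_eq \<Phi> (\<psi>1, \<psi>2) \<or> halfline_eq \<Phi> (\<psi>2, \<psi>1)"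
      unfolding global_minimizer_def using energy_minimal(2) pq_admissible by blast
  next
    assume "halfline_eq \<Phi> (\<psi>1, \<psi>2) \<or> halfline_eq \<Phi> (\<psi>2, \<psi>1)"
    then have "\<Phi> \<in> admissible \<alpha> \<and> energy \<epsilon> \<gamma> \<Phi> = energy \<epsilon> \<gamma> (\<psi>1, \<psi>2)"
      using energy_halfline_eq pq_admissible energy_swap[OF pq_admissible] by metis
    then show "global_minimizer \<epsilon> \<gamma> \<alpha> \<Phi>"
      unfolding global_minimizer_def using energy_minimal(1) by simp
  qed
qed

end
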